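(* Suppose that $X$ is complete, and let $1 \le q < \infty$. For every $f \in \mathfrak{t}^{1,q}(\gamma)$ there exist $5$-$\mathfrak{t}^{1,q}$-atoms $a_k$ and scalars $\lambda_k$ ($k$ ranging over a countable index set) such that $$ f = \sum_k \lambda_k a_k , $$ with convergence in $\mathfrak{t}^{1,q}(\gamma)$, and $$ \sum_k |\lambda_k| \simeq \| f \|_{\mathfrak{t}^{1,q}(\gamma)}, $$ where the implicit constants do not depend on $f$.
   Context: $(X,d,\mu)$ is a metric measure space: a metric space $(X,d)$ with a Borel measure $\mu$. Every ball $B \subset X$ is understood to come with a given centre $c_B$ and radius $r_B>0$ ($B = B(c_B,r_B)$, with $B(x,r)=\{y : d(x,y)<r\}$), and $\mu(B)$ is finite and nonzero. For $\lambda\ge 1$, $\lambda B := B(c_B,\lambda r_B)$. $(X,d)$ is geometrically doubling: there is a natural number $N\ge 1$ such that for every ball $B$ of radius $r_B$ there exist at most $N$ mutually disjoint balls of radius $r_B/2$ contained in $B$. $\varphi$ is a measurable real-valued function on $X$ and $d\gamma(x) := e^{-\varphi(x)}\,d\mu(x)$. A function $m : X \to (0,\infty)$ (the admissibility function) is fixed. For $\alpha>0$ the family of $\alpha$-admissible balls is $\mathcal{B}_\alpha := \{ B\subset X : 0<r_B\le \alpha m(c_B)\}$. Standing assumption: for every $\alpha>0$ there is a constant $C_\alpha\ge 1$ such that $\gamma(2B)\le C_\alpha\gamma(B)$ for all $B\in\mathcal{B}_\alpha$. Let $D=\{(y,t)\in X\times(0,\infty) : t<m(y)\}$ and $\Gamma(x)=\{(y,t)\in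 D : d(x,y)<t\}$. For a measurable function $f$ on $D$ put $$\mathcal{A}_q f(x)=\Big(\iint_{\Gamma(x)}|f(y,t)|^q\,\frac{d\gamma(y)}{\gamma(B(y,t))}\frac{dt}{t}\Big)^{1/q}.$$ The local tent space $\mathfrak{t}^{1,q}(\gamma)$ consists of all measurable $f$ on $D$ with $\|f\|_{\mathfrak{t}^{1,q}(\gamma)}:=\|\mathcal{A}_qf\|_{L^1(\gamma)}<\infty$. For an open set $O\subset X$, the admissible tent over $O$ is $T(O):=D\setminus\bigcup_{x\in X\setminus O}\Gamma(x)$. For $\alpha>0$, a function $a$ on $D$ is called an $\alpha$-$\mathfrak{t}^{1,q}$-atom if there exists a ball $B\in\mathcal{B}_\alpha$ such that $\operatorname{supp} a\subset T(B)$ and $$\iint_{T(B)}|a(y,t)|^q\,d\gamma(y)\frac{dt}{t}\le\frac{1}{\gamma(B)^{q-1}}.$$ *)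

theory Defs
  imports "HOL-Analysis.Analysis"
begin

text \<open>
  A ball is represented by its centre and radius: \<open>(c, r)\<close> with \<open>r > 0\<close> stands for
  \<open>ball c r\<close>. The space \<open>X\<close> is the whole of a type of class \<^class>\<open>metric_space\<close>.
\<close>

text \<open>
  The two conjuncts on \<open>C\<close> say that \<open>C\<close> is the set of centres of at most \<open>N\<close> balls
  (in particular, of finitely many; \<^const>\<open>card\<close> of an infinite set is 0).
\<close>

definition geometrically_doubling :: "'a::metric_space itself \<Rightarrow> bool" where
  "geometrically_doubling _ \<longleftrightarrow>
    (\<exists>N::nat. 1 \<le> N \<and>
      (\<forall>(x::'a) r C. 0 < r \<longrightarrow>
         disjoint_family_on (\<lambda>c. ball c (r / 2)) C \<longrightarrow>
         (\<forall>c\<in>C. ball c (r / 2) \<subseteq> ball x r) \<longrightarrow>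
         finite C \<and> card C \<le> N))"

definition admissible_balls :: "('a \<Rightarrow> real) \<Rightarrow> real \<Rightarrow> ('a \<times> real) set" where
  "admissible_balls m \<alpha> = {(c, r). 0 < r \<and> r \<le> \<alpha> * m c}"

definition admissibly_doubling :: "'a::metric_space measure \<Rightarrow> ('a \<Rightarrow> real) \<Rightarrow> bool" where
  "admissibly_doubling \<gamma> m \<longleftrightarrow>
    (\<forall>\<alpha>>0. \<exists>C::real. 1 \<le> C \<and>
      (\<forall>(c, r) \<in> admissible_balls m \<alpha>.
         emeasure \<gamma> (ball c (2 * r)) \<le> ennreal C * emeasure \<gamma> (ball c r)))"

definition local_half_space :: "('a \<Rightarrow> real) \<Rightarrow> ('a \<times> real) set" where
  "local_half_space m = {(y, t). 0 < t \<and> t < m y}"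

definition local_cone :: "('a::metric_space \<Rightarrow> real) \<Rightarrow> 'a \<Rightarrow> ('a \<times> real) set" where
  "local_cone m x = {(y, t) \<in> local_half_space m. dist x y < t}"

definition admissible_tent :: "('a::metric_space \<Rightarrow> real) \<Rightarrow> 'a set \<Rightarrow> ('a \<times> real) set" where
  "admissible_tent m U = local_half_space m - (\<Union>x\<in>- U. local_cone m x)"

text \<open>The measure \<open>d\<gamma>(y) dt/t\<close> on \<open>X \<times> (0,\<infinity>)\<close>, extended by zero to \<open>X \<times> \<real>\<close>.\<close>

definition upper_measure :: "'a measure \<Rightarrow> ('a \<times> real) measure" where
  "upper_measure \<gamma> = \<gamma> \<Otimes>\<^sub>M density lborel (\<lambda>t. indicator {0<..} t * ennreal (1 / t))"

text \<open>
  Real powers on \<open>[0,\<infinity>]\<close>, used for exponents \<open>p \<ge> 0\<close>, with \<open>x\<^sup>0 = 1\<close> for all \<open>x\<close>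
  (\<^const>\<open>powr\<close> satisfies \<open>0 powr 0 = 0\<close>).
\<close>

definition ennreal_powr :: "ennreal \<Rightarrow> real \<Rightarrow> ennreal" where
  "ennreal_powr x p =
    (if p = 0 then 1 else if x = \<infinity> then \<infinity> else ennreal (enn2real x powr p))"

definition area_functional ::
  "'a::metric_space measure \<Rightarrow> ('a \<Rightarrow> real) \<Rightarrow> real \<Rightarrow> ('a \<times> real \<Rightarrow> 'b::real_normed_vector) \<Rightarrow> 'a \<Rightarrow> ennreal"
where
  "area_functional \<gamma> m q f x =
    ennreal_powr
      (\<integral>\<^sup>+z\<in>local_cone m x. ennreal (norm (f z) powr q) / emeasure \<gamma> (ball (fst z) (snd z))
         \<partial>upper_measure \<gamma>)
      (1 / q)"

definition tent_norm ::
  "'a::metric_space measure \<Rightarrow> ('a \<Rightarrow> real) \<Rightarrow> real \<Rightarrow> ('a \<times> real \<Rightarrow> 'b::real_normed_vector) \<Rightarrow> ennreal"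
where
  "tent_norm \<gamma> m q f = (\<integral>\<^sup>+x. area_functional \<gamma> m q f x \<partial>\<gamma>)"

text \<open>
  A function on \<open>D = local_half_space m\<close> is represented by a total function on \<open>X \<times> \<real>\<close>
  whose values outside \<open>D\<close> are irrelevant; measurability on \<open>D\<close> is
  \<^const>\<open>set_borel_measurable\<close>, that is, measurability of the extension by zero.
\<close>

definition local_tent_space ::
  "'a::metric_space measure \<Rightarrow> ('a \<Rightarrow> real) \<Rightarrow> real \<Rightarrow> ('a \<times> real \<Rightarrow> 'b::real_normed_vector) set"
where
  "local_tent_space \<gamma> m q =
    {f. set_borel_measurable (upper_measure \<gamma>) (local_half_space m) f \<and> tent_norm \<gamma> m q f < \<infinity>}"

text \<open>
  Since cones are relatively open, \<open>admissible_tent m (ball c r)\<close> is relatively closed in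
  \<open>D\<close>; so it contains the set where \<open>a\<close> is nonzero iff it contains the relative closure
  of that set.
\<close>

definition tent_atom ::
  "'a::metric_space measure \<Rightarrow> ('a \<Rightarrow> real) \<Rightarrow> real \<Rightarrow> real \<Rightarrow> ('a \<times> real \<Rightarrow> 'b::real_normed_vector) \<Rightarrow> bool"
where
  "tent_atom \<gamma> m q \<alpha> a \<longleftrightarrow>
    set_borel_measurable (upper_measure \<gamma>) (local_half_space m) a \<and>
    (\<exists>(c, r) \<in> admissible_balls m \<alpha>.
       support_on (local_half_space m) a \<subseteq> admissible_tent m (ball c r) \<and>
       (\<integral>\<^sup>+z\<in>admissible_tent m (ball c r). ennreal (norm (a z) powr q) \<partial>upper_measure \<gamma>)
         \<le> 1 / ennreal_powr (emeasure \<gamma> (ball c r)) (q - 1))"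

end

theory Submission
  imports Defs
begin

text \<open>
  The proof works with the density \<open>h = |f|\<^sup>q\<close> on \<open>D\<close>, extended by zero to \<open>X \<times> \<real>\<close>, and with
  sets of points \<open>(y, t)\<close> that stand for their balls \<open>B(y, t)\<close>. The balls with \<open>(y, t) \<in> D\<close> are
  admissible, and \<open>(y, t) \<in> T(B)\<close> means just that \<open>B(y, t) \<subseteq> B\<close>. These two facts make a plain Vitali
  selection take the place of a Whitney decomposition.

  Fix a level \<open>i\<close>, let \<open>O\<^sub>i\<close> be the set where the area functional \<open>A f\<close> of \<open>f\<close> exceeds
  \<open>2 powr i\<close>, and call a point heavy if more than half of the mass of its ball lies in
  \<open>O\<^sub>i\<close>. Vitali selection among the balls of heavy points, called heavy balls, gives disjoint balls \<open>B\<^sub>n\<close> such that every heavy ball lies in some \<open>5B\<^sub>n\<close>; so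
  the tents over the balls \<open>5B\<^sub>n\<close> cover the heavy points, and \<open>\<gamma>(5B\<^sub>n) \<le> K \<gamma>(B\<^sub>n) \<le> 2K \<gamma>(B\<^sub>n \<inter> O\<^sub>i)\<close>
  sums to at most \<open>2K \<gamma>(O\<^sub>i)\<close> (\<open>selected_balls\<close>). Let \<open>F\<close> be a set of points which are
  heavy at level \<open>i\<close>, not heavy at level \<open>i + 1\<close>, and have their balls in \<open>5B\<^sub>n\<close>. At least half of each
  such ball lies outside \<open>O\<close> of level \<open>i + 1\<close>, so by Tonelli the integral of \<open>h\<close> over \<open>F\<close> is
  at most twice the integral of \<open>(A f)\<^sup>q\<close> over \<open>5B\<^sub>n\<close> minus that set, where \<open>A f \<le> 2 powr (i + 1)\<close>. Hence
  the restriction of \<open>f\<close> to \<open>F\<close> is an atom times \<open>4 (2 powr i) \<gamma>(5B\<^sub>n)\<close> (\<open>atomic_set_heavy_diff\<close>).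
  These coefficients sum to at most a constant times the sum of \<open>(2 powr i) \<gamma>(O\<^sub>i)\<close>, which is
  comparable to the integral of \<open>A f\<close>. Almost every point where \<open>h\<close> matters is heavy at some
  level but not at all of them, so the sets \<open>F\<close> exhaust \<open>f\<close>
  (\<open>AE_some_heavy\<close>, \<open>not_all_heavy\<close>, \<open>atomic_partition_bounded\<close>).

  Vitali selection requires bounded radii, whereas \<open>m\<close> may be unbounded. Since the part of
  \<open>f\<close> over \<open>t > R\<close> tends to zero in norm, \<open>f\<close> is first cut into bands \<open>R\<^sub>j < t \<le> R\<^sub>j\<^sub>+\<^sub>1\<close> with
  \<open>R\<^sub>j\<close> growing so fast that the norms of the bands decay geometrically
  (\<open>atomic_partition_exists\<close>).

  All pieces have disjoint supports. So the remainders of the series are restrictions of \<open>f\<close>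
  to sets shrinking to a negligible one, and they tend to zero by dominated convergence
  (\<open>tent_size_tendsto_0\<close>). For the converse inequality, the area functional is countably
  subadditive over the pieces, because \<open>x powr (1/q)\<close> is, and each atom has norm at most 2
  (\<open>tent_size_le_sum_atomic_sets\<close>).
\<close>

section \<open>A covering lemma in metric spaces\<close>

abbreviation ball_of :: "'a::metric_space \<times> real \<Rightarrow> 'a set" where
  "ball_of z \<equiv> ball (fst z) (snd z)"

text \<open>
  Zorn's lemma is applied to the disjoint subfamilies with the extra property that a ball of
  \<open>K\<close> meeting the subfamily meets one of its balls of at least half the radius. In a
  maximal one every ball of \<open>K\<close> meets the subfamily: among the balls that do not, one of
  nearly maximal radius could be added.
\<close>

lemma vitali_covering_bounded_radii:
  fixes K :: "('a::metric_space \<times> real) set"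
  assumes bd: "\<And>z. z \<in> K \<Longrightarrow> 0 < snd z \<and> snd z \<le> R"
  obtains C where "C \<subseteq> K" "disjoint_family_on ball_of C"
    "\<And>z. z \<in> K \<Longrightarrow> \<exists>w\<in>C. ball_of z \<subseteq> ball (fst w) (5 * snd w)"
proof -
  define meets where "meets z w \<longleftrightarrow> ball_of z \<inter> ball_of w \<noteq> {}" for z w :: "'a \<times> real"
  define \<A> where "\<A> = {C. C \<subseteq> K \<and> disjoint_family_on ball_of C \<and>
    (\<forall>z\<in>K. (\<exists>w\<in>C. meets z w) \<longrightarrow> (\<exists>w\<in>C. meets z w \<and> snd z \<le> 2 * snd w))}"
  have "\<exists>M\<in>\<A>. \<forall>X\<in>\<A>. M \<subseteq> X \<longrightarrow> X = M"
  proof (rule subset_Zorn')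
    fix \<C> assume ch: "subset.chain \<A> \<C>"
    then have sub: "\<C> \<subseteq> \<A>" and lin: "\<And>X Y. X \<in> \<C> \<Longrightarrow> Y \<in> \<C> \<Longrightarrow> X \<subseteq> Y \<or> Y \<subseteq> X"
      unfolding subset.chain_def by blast+
    have "disjoint_family_on ball_of (\<Union>\<C>)"
      unfolding disjoint_family_on_def
    proof (intro ballI impI)
      fix z w assume "z \<in> \<Union>\<C>" "w \<in> \<Union>\<C>" and ne: "z \<noteq> w"
      then obtain X where "X \<in> \<C>" "z \<in> X" "w \<in> X" using lin by blast
      with sub ne show "ball_of z \<inter> ball_of w = {}"
        unfolding \<A>_def disjoint_family_on_def by blast
    qed
    moreover have "\<Union>\<C> \<subseteq> K" using sub unfolding \<A>_def by blast
    moreover have "\<forall>z\<in>K. (\<exists>w\<in>\<Union>\<C>. meets z w) \<longrightarrow> (\<exists>w\<in>\<Union>\<C>. meets z w \<and> snd z \<le> 2 * snd w)"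
    proof (intro ballI impI)
      fix z assume "z \<in> K" "\<exists>w\<in>\<Union>\<C>. meets z w"
      then obtain X w where X: "X \<in> \<C>" "w \<in> X" "meets z w" by blast
      then have "\<exists>w\<in>X. meets z w \<and> snd z \<le> 2 * snd w"
        using sub \<open>z \<in> K\<close> unfolding \<A>_def by blast
      with X show "\<exists>w\<in>\<Union>\<C>. meets z w \<and> snd z \<le> 2 * snd w" by blast
    qed
    ultimately show "\<Union>\<C> \<in> \<A>" unfolding \<A>_def by blast
  qed
  then obtain M where M: "M \<in> \<A>" and max: "\<And>X. X \<in> \<A> \<Longrightarrow> M \<subseteq> X \<Longrightarrow> X = M" by blast
  have all_meet: "\<exists>w\<in>M. meets z w" if zK: "z \<in> K" for z
  proof (rule ccontr)
    assume no: "\<not> (\<exists>w\<in>M. meets z w)"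
    \<comment> \<open>Bounded radii are used here: \<open>L\<close> has a member whose radius is at least half of any other.\<close>
    define L where "L = {z\<in>K. \<not> (\<exists>w\<in>M. meets z w)}"
    have zL: "z \<in> L" using no zK unfolding L_def by blast
    have LK: "L \<subseteq> K" unfolding L_def by blast
    have bdd: "bdd_above (snd ` L)" using bd LK by (intro bdd_aboveI[of _ R]) auto
    have "snd z \<le> Sup (snd ` L)" using zL bdd by (intro cSUP_upper)
    then have pos: "0 < Sup (snd ` L)" using bd[OF zK] by linarith
    then have "Sup (snd ` L) / 2 < Sup (snd ` L)" by simp
    then obtain u where u: "u \<in> L" "Sup (snd ` L) / 2 < snd u"
      using less_cSUP_iff[of L snd] zL bdd by blast
    have half: "snd v \<le> 2 * snd u" if "v \<in> L" for v
      using cSUP_upper[OF that bdd] u by simp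
    have uu: "meets u u" using u LK bd[of u] unfolding meets_def by force
    have "insert u M \<in> \<A>"
    proof -
      have "disjoint_family_on ball_of (insert u M)"
        using M u unfolding \<A>_def L_def meets_def disjoint_family_on_def by blast
      moreover have "insert u M \<subseteq> K" using M u LK unfolding \<A>_def by blast
      moreover have "\<exists>w\<in>insert u M. meets z w \<and> snd z \<le> 2 * snd w"
        if "z \<in> K" "\<exists>w\<in>insert u M. meets z w" for z
      proof (cases "\<exists>w\<in>M. meets z w")
        case True
        then show ?thesis using M that unfolding \<A>_def by blast
      next
        case False
        then have "z \<in> L" using that unfolding L_def by blast
        then show ?thesis using half that False by blast
      qed
      ultimately show ?thesis unfolding \<A>_def by blast
    qed
    then have "u \<in> M" using max by blast
    then show False using u uu unfolding L_def by blast
  qed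
  have "\<exists>w\<in>M. ball_of z \<subseteq> ball (fst w) (5 * snd w)" if zK: "z \<in> K" for z
  proof -
    obtain w where w: "w \<in> M" "meets z w" "snd z \<le> 2 * snd w"
      using all_meet[OF zK] M zK unfolding \<A>_def by blast
    then obtain p where p: "dist (fst z) p < snd z" "dist (fst w) p < snd w"
      unfolding meets_def by auto
    have "dist (fst w) x < 5 * snd w" if "dist (fst z) x < snd z" for x
    proof -
      have "dist (fst w) x \<le> dist (fst w) p + dist p (fst z) + dist (fst z) x"
        using dist_triangle[of "fst w" x p] dist_triangle[of p x "fst z"] by linarith
      with p that w show ?thesis by (simp add: dist_commute)
    qed
    with w show ?thesis by (auto simp: subset_iff)
  qed
  with M show ?thesis using that unfolding \<A>_def by blast
qed

text \<open>
  In a set of finite measure only finitely many disjoint sets can have mass above a given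
  \<open>1 / Suc k\<close>.
\<close>

lemma (in sigma_finite_measure) countable_disjoint_positive_measure:
  assumes disj: "disjoint_family_on A I"
    and pos: "\<And>i. i \<in> I \<Longrightarrow> A i \<in> sets M \<and> emeasure M (A i) \<noteq> 0"
  shows "countable I"
proof -
  obtain S :: "nat \<Rightarrow> 'a set" where S: "range S \<subseteq> sets M" "(\<Union>i. S i) = space M"
    "\<And>i. emeasure M (S i) \<noteq> \<infinity>" by (metis sigma_finite)
  define P where "P n k = {i\<in>I. ennreal (1 / real (Suc k)) < emeasure M (A i \<inter> S n)}" for n k :: nat
  have "finite (P n k)" for n k
  proof (rule ccontr)
    assume "infinite (P n k)"
    then obtain e :: "nat \<Rightarrow> 'b" where e: "inj e" "range e \<subseteq> P n k"
      using infinite_countable_subset by blast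
    have eI: "e j \<in> I" and lo: "ennreal (1 / real (Suc k)) < emeasure M (A (e j) \<inter> S n)" for j
      using e unfolding P_def by blast+
    have "disjoint_family (\<lambda>j. A (e j) \<inter> S n)"
      using disj eI e(1) unfolding disjoint_family_on_def inj_def by blast
    then have "(\<Sum>j. emeasure M (A (e j) \<inter> S n)) = emeasure M (\<Union>j. A (e j) \<inter> S n)"
      using eI pos S by (intro suminf_emeasure) auto
    also have "\<dots> \<le> emeasure M (S n)" using S by (intro emeasure_mono) auto
    finally have le: "(\<Sum>j. emeasure M (A (e j) \<inter> S n)) \<le> emeasure M (S n)" .
    have "(\<Sum>j::nat. ennreal (1 / real (Suc k))) \<le> (\<Sum>j. emeasure M (A (e j) \<inter> S n))"
      using lo by (intro suminf_le) (auto intro: less_imp_le)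
    moreover have "(\<Sum>j::nat. ennreal (1 / real (Suc k))) = \<infinity>"
    proof (rule ccontr)
      assume "(\<Sum>j::nat. ennreal (1 / real (Suc k))) \<noteq> \<infinity>"
      then have "summable (\<lambda>j::nat. 1 / real (Suc k))"
        by (intro summable_suminf_not_top) simp_all
      then show False unfolding summable_const_iff by simp
    qed
    ultimately show False using le S(3)[of n] by (simp add: top_unique)
  qed
  moreover have "I \<subseteq> (\<Union>n k. P n k)"
  proof
    fix i assume i: "i \<in> I"
    have "\<exists>n. emeasure M (A i \<inter> S n) \<noteq> 0"
    proof (rule ccontr)
      assume "\<not> ?thesis"
      then have "emeasure M (\<Union>n. A i \<inter> S n) = 0"
        using pos[OF i] S by (intro emeasure_UN_eq_0) auto
      moreover have "(\<Union>n. A i \<inter> S n) = A i" using S(2) sets.sets_into_space[of "A i" M] pos[OF i] by auto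
      ultimately show False using pos[OF i] by simp
    qed
    then obtain n where "emeasure M (A i \<inter> S n) \<noteq> 0" by blast
    then obtain k where "ennreal (1 / real (Suc k)) < emeasure M (A i \<inter> S n)"
    proof (cases "emeasure M (A i \<inter> S n)" rule: ennreal_cases)
      case (real r)
      with \<open>emeasure M (A i \<inter> S n) \<noteq> 0\<close> have "0 < r" by (cases "r = 0") auto
      then obtain k where "1 / real (Suc k) < r" by (rule nat_approx_posE)
      with real \<open>0 < r\<close> show ?thesis by (intro that[of k]) (simp add: ennreal_lessI)
    next
      case top
      then show ?thesis by (intro that[of 0]) simp
    qed
    then show "i \<in> (\<Union>n k. P n k)" using i unfolding P_def by blast
  qed
  ultimately show ?thesis
    by (intro countable_subset[of I "\<Union>n k. P n k"]) (simp_all add: countable_finite)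
qed

section \<open>Real powers and dyadic sums in the extended half-line\<close>

lemma ennreal_powr_0 [simp]: "0 < p \<Longrightarrow> ennreal_powr 0 p = 0"
  by (simp add: ennreal_powr_def)

lemma ennreal_powr_ennreal: "0 < p \<Longrightarrow> 0 \<le> x \<Longrightarrow> ennreal_powr (ennreal x) p = ennreal (x powr p)"
  by (simp add: ennreal_powr_def)

lemma measurable_ennreal_powr [measurable]:
  assumes [measurable]: "f \<in> borel_measurable M"
  shows "(\<lambda>x. ennreal_powr (f x) p) \<in> borel_measurable M"
  unfolding ennreal_powr_def by measurable

lemma ennreal_powr_mono: "0 \<le> p \<Longrightarrow> x \<le> y \<Longrightarrow> ennreal_powr x p \<le> ennreal_powr y p"
  unfolding ennreal_powr_def
  by (auto simp: top_unique less_top intro!: ennreal_leI powr_mono2 enn2real_mono)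

lemma ennreal_powr_leD:
  assumes "0 < p" "0 \<le> c" "ennreal_powr x p \<le> ennreal c"
  shows "x \<le> ennreal (c powr (1 / p))"
proof (cases x rule: ennreal_cases)
  case (real r)
  then have "r powr p \<le> c" using assms by (simp add: ennreal_powr_ennreal)
  then have "(r powr p) powr (1 / p) \<le> c powr (1 / p)" using assms by (intro powr_mono2) auto
  then show ?thesis using real assms by (simp add: powr_powr ennreal_leI)
qed (use assms in \<open>auto simp: ennreal_powr_def top_unique\<close>)

lemma ennreal_powr_eq_0_iff: "0 < p \<Longrightarrow> ennreal_powr x p = 0 \<longleftrightarrow> x = 0"
  by (cases x rule: ennreal_cases) (auto simp: ennreal_powr_def)

lemma ennreal_powr_eq_top_iff: "0 < p \<Longrightarrow> ennreal_powr x p = \<infinity> \<longleftrightarrow> x = \<infinity>"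
  by (auto simp: ennreal_powr_def)

lemma tendsto_ennreal_powr_0:
  assumes "0 < p" "(X \<longlongrightarrow> 0) F"
  shows "((\<lambda>n. ennreal_powr (X n) p) \<longlongrightarrow> 0) F"
proof -
  have "((\<lambda>n. ennreal (enn2real (X n) powr p)) \<longlongrightarrow> ennreal (0 powr p)) F"
    using assms tendsto_enn2real[of X 0 F] by (intro tendsto_ennrealI tendsto_powr') auto
  moreover have "eventually (\<lambda>n. X n < 1) F"
    using order_tendstoD(2)[OF assms(2), of 1] by simp
  then have "eventually (\<lambda>n. ennreal (enn2real (X n) powr p) = ennreal_powr (X n) p) F"
    by eventually_elim (use assms(1) in \<open>auto simp: ennreal_powr_def\<close>)
  ultimately show ?thesis using assms(1) by (auto intro: Lim_transform_eventually)
qed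

text \<open>
  Let \<open>T\<close> be the sum of the powers. Each \<open>x k powr p\<close> is at most \<open>T\<close>, so
  \<open>x k \<le> T powr (1/p - 1) * x k powr p\<close>, and these bounds sum to \<open>T powr (1/p)\<close>.
\<close>

lemma ennreal_powr_suminf_le:
  fixes x :: "nat \<Rightarrow> ennreal"
  assumes p: "0 < p" "p \<le> 1"
  shows "ennreal_powr (\<Sum>k. x k) p \<le> (\<Sum>k. ennreal_powr (x k) p)"
proof (cases "\<Sum>k. ennreal_powr (x k) p" rule: ennreal_cases)
  case (real T)
  have le: "x k \<le> ennreal (T powr (1 / p - 1)) * ennreal_powr (x k) p" for k
  proof -
    have xT: "ennreal_powr (x k) p \<le> ennreal T"
      using sum_le_suminf[of "\<lambda>k. ennreal_powr (x k) p" "{k}"] real by simp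
    show ?thesis
    proof (cases "x k" rule: ennreal_cases)
      case r: (real r)
      show ?thesis
      proof (cases "r = 0")
        case False
        then have "0 < r" using r by simp
        have rT: "r powr p \<le> T" using xT r p real by (simp add: ennreal_powr_ennreal)
        have "r = (r powr p) powr (1 / p - 1) * r powr p"
          using \<open>0 < r\<close> p by (simp add: powr_powr powr_add[symmetric] field_simps)
        also have "\<dots> \<le> T powr (1 / p - 1) * r powr p"
          using rT p by (intro mult_right_mono powr_mono2) (auto simp: field_simps)
        finally show ?thesis
          using r p by (simp add: ennreal_powr_ennreal ennreal_mult[symmetric] ennreal_leI)
      qed (use r in simp)
    next
      case top
      then show ?thesis using xT p by (simp add: ennreal_powr_def top_unique)
    qed
  qed
  have "(\<Sum>k. x k) \<le> (\<Sum>k. ennreal (T powr (1 / p - 1)) * ennreal_powr (x k) p)"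
    by (intro suminf_le le) auto
  also have "\<dots> = ennreal (T powr (1 / p - 1) * T)" using real by (simp add: ennreal_mult)
  also have "T powr (1 / p - 1) * T = T powr (1 / p)"
    using real by (cases "T = 0") (simp_all add: powr_diff)
  finally have "ennreal_powr (\<Sum>k. x k) p \<le> ennreal_powr (ennreal (T powr (1 / p))) p"
    using p by (intro ennreal_powr_mono) auto
  also have "\<dots> = ennreal T" using p real by (simp add: ennreal_powr_ennreal powr_powr)
  finally show ?thesis using real by simp
qed simp

text \<open>
  This is \<open>v powr (1/q) \<le> 1 + v\<close>, rescaled. It takes the place of Hoelder's inequality in the
  bound on the norm of an atom, at the price of a factor 2.
\<close>

lemma ennreal_powr_le_affine:
  assumes q: "1 \<le> q" and s: "0 < s"
  shows "ennreal_powr x (1 / q) \<le> ennreal s * (1 + ennreal (1 / s powr q) * x)"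
proof (cases x rule: ennreal_cases)
  case (real r)
  define v where "v = r / s powr q"
  have v: "0 \<le> v" using real s by (simp add: v_def)
  have "v powr (1 / q) \<le> 1 + v"
  proof (cases "v \<le> 1")
    case True
    then have "v powr (1 / q) \<le> 1 powr (1 / q)" using v q by (intro powr_mono2) auto
    then show ?thesis using v by simp
  next
    case False
    then have "v powr (1 / q) \<le> v powr 1" using q by (intro powr_mono) auto
    then show ?thesis using v by simp
  qed
  then have "s * v powr (1 / q) \<le> s * (1 + v)" using s by (intro mult_left_mono) auto
  moreover have "s * v powr (1 / q) = r powr (1 / q)"
    using s real q by (simp add: v_def powr_divide powr_powr)
  ultimately have "ennreal (r powr (1 / q)) \<le> ennreal (s * (1 + v))" by (simp add: ennreal_leI)
  also have "\<dots> = ennreal s * ennreal (1 + v)" using s v by (intro ennreal_mult) auto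
  also have "ennreal (1 + v) = 1 + ennreal v" using v by simp
  also have "ennreal v = ennreal (1 / s powr q) * x"
    using real by (simp add: v_def ennreal_mult[symmetric])
  finally show ?thesis using real q by (simp add: ennreal_powr_ennreal)
next
  case top
  have "ennreal (1 / s powr q) * top = top" using s by (subst ennreal_mult_top) auto
  then show ?thesis using s top by (simp add: ennreal_mult_top)
qed

text \<open>
  The number \<open>2 powr i\<close> is twice the length of the interval from \<open>2 powr (i - 1)\<close> to \<open>2 powr i\<close>.
  For the indices that contribute, these intervals are disjoint and contained in \<open>[0, a]\<close>. The
  integers are enumerated by \<open>int_decode\<close>.
\<close>

lemma sum_dyadic_layers_le:
  fixes a :: ennreal
  shows "(\<Sum>n. ennreal (2 powr real_of_int (int_decode n))
    * indicator {ennreal (2 powr real_of_int (int_decode n))<..} a) \<le> 2 * a"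
proof (cases a rule: ennreal_cases)
  case (real r)
  define I where "I n = (if 2 powr real_of_int (int_decode n) < r
    then {2 powr (real_of_int (int_decode n) - 1)<..2 powr real_of_int (int_decode n)} else {})" for n
  have "disjoint_family I"
    unfolding disjoint_family_on_def
  proof (intro ballI impI)
    have aux: "I n \<inter> I k = {}" if "int_decode n < int_decode k" for n k
    proof -
      have "2 powr real_of_int (int_decode n) \<le> 2 powr (real_of_int (int_decode k) - 1)"
        using that by (intro powr_mono) auto
      then show ?thesis unfolding I_def by auto
    qed
    fix n k :: nat assume "n \<noteq> k"
    then have "int_decode n \<noteq> int_decode k" using bij_int_decode by (simp add: bij_def inj_eq)
    then show "I n \<inter> I k = {}" using aux[of n k] aux[of k n] by (cases "int_decode n < int_decode k") auto
  qed
  moreover have "range I \<subseteq> sets lborel" unfolding I_def by auto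
  ultimately have "(\<Sum>n. emeasure lborel (I n)) = emeasure lborel (\<Union>n. I n)"
    by (intro suminf_emeasure)
  also have "\<dots> \<le> emeasure lborel {0..r}"
  proof (intro emeasure_mono UN_least subsetI)
    fix n x assume "x \<in> I n"
    then have "2 powr (real_of_int (int_decode n) - 1) < x" "x \<le> r"
      by (auto simp: I_def split: if_splits)
    moreover have "0 < 2 powr (real_of_int (int_decode n) - 1)" by simp
    ultimately have "0 \<le> x" by linarith
    with \<open>x \<le> r\<close> show "x \<in> {0..r}" by simp
  qed simp
  finally have le: "(\<Sum>n. emeasure lborel (I n)) \<le> a" using real by simp
  have "ennreal (2 powr real_of_int (int_decode n))
    * indicator {ennreal (2 powr real_of_int (int_decode n))<..} a = 2 * emeasure lborel (I n)" for n
  proof -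
    have "2 powr (real_of_int (int_decode n) - 1) = 2 powr real_of_int (int_decode n) / 2"
      by (simp add: powr_diff)
    then show ?thesis
      using real by (auto simp: I_def ennreal_less_iff indicator_def ennreal_mult'[symmetric] 
          simp flip: ennreal_numeral)
  qed
  then show ?thesis using mult_left_mono[OF le, of 2] by simp
qed (simp add: ennreal_mult_eq_top_iff)

lemma le_twice_rest:
  fixes a b c :: ennreal
  assumes "a + b = c" "c \<noteq> \<infinity>" "2 * a \<le> c"
  shows "c \<le> 2 * b"
proof -
  have fin: "a \<noteq> \<infinity>" "b \<noteq> \<infinity>" using assms(1,2) by auto
  have "a + a \<le> a + b" using assms by (simp add: mult_2)
  then have "a \<le> b" using fin by (simp add: ennreal_add_left_cancel_le)
  then show ?thesis using assms(1) by (metis add_right_mono mult_2)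
qed

section \<open>Measurability over an admissible measure\<close>

text \<open>
  Balls have positive mass, possibly infinite. No regularity of \<open>m\<close> is assumed, so the half-space \<open>D\<close> and the cones need not be
  measurable sets.
\<close>

locale admissible_measure = sigma_finite_measure \<gamma>
  for \<gamma> :: "'a::metric_space measure" +
  fixes m :: "'a \<Rightarrow> real" and q :: real
  assumes sets_eq_borel [measurable_cong]: "sets \<gamma> = sets borel"
    and ball_pos: "0 < r \<Longrightarrow> emeasure \<gamma> (ball x r) \<noteq> 0"
    and m_pos: "0 < m x"
    and doubling: "admissibly_doubling \<gamma> m"
    and q_ge_1: "1 \<le> q"
begin

abbreviation "D \<equiv> local_half_space m"
abbreviation "U \<equiv> upper_measure \<gamma>"

lemma q_pos: "0 < q" using q_ge_1 by simp

lemma space_\<gamma> [simp]: "space \<gamma> = UNIV"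
  using sets_eq_imp_space_eq[OF sets_eq_borel] by simp

lemma ball_in_sets [measurable, simp]: "ball x r \<in> sets \<gamma>"
  by (simp add: sets_eq_borel)

lemma sets_U [measurable_cong]: "sets U = sets (\<gamma> \<Otimes>\<^sub>M borel)"
  unfolding upper_measure_def by (intro sets_pair_measure_cong) auto

lemma sigma_finite_U: "sigma_finite_measure U"
proof -
  have "sigma_finite_measure (density lborel (\<lambda>t. indicator {0<..} t * ennreal (1 / t)))"
    by (subst sigma_finite_measure.sigma_finite_iff_density_finite[OF lborel.sigma_finite_measure_axioms])
      (auto intro!: AE_I2 simp: indicator_def ennreal_mult_eq_top_iff)
  then show ?thesis
    unfolding upper_measure_def by (intro sigma_finite_pair_measure sigma_finite_measure_axioms)
qed

sublocale U: sigma_finite_measure U by (rule sigma_finite_U)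
sublocale \<gamma>U: pair_sigma_finite \<gamma> U ..

lemma countable_disjoint_balls:
  fixes C :: "('a \<times> real) set"
  assumes "disjoint_family_on ball_of C" "\<And>z. z \<in> C \<Longrightarrow> 0 < snd z"
  shows "countable C"
  by (rule countable_disjoint_positive_measure[OF assms(1)]) (auto simp: assms(2) ball_pos)

text \<open>
  Selecting disjoint balls among all balls of radius \<open>\<epsilon>\<close> gives a \<open>5\<epsilon>\<close>-net, which is countable
  because disjoint balls have positive mass.
\<close>

lemma countable_dense:
  obtains S :: "'a set" where "countable S" "\<And>x \<epsilon>. 0 < \<epsilon> \<Longrightarrow> \<exists>s\<in>S. dist x s < \<epsilon>"
proof -
  have step: "\<exists>C::'a set. countable C \<and> (\<forall>x. \<exists>s\<in>C. dist x s < 5 / real (Suc n))" for n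
  proof -
    let ?K = "UNIV \<times> {1 / real (Suc n)} :: ('a \<times> real) set"
    obtain C where C: "C \<subseteq> ?K" "disjoint_family_on ball_of C"
      "\<And>z. z \<in> ?K \<Longrightarrow> \<exists>w\<in>C. ball_of z \<subseteq> ball (fst w) (5 * snd w)"
      by (rule vitali_covering_bounded_radii[of ?K "1 / real (Suc n)"]) auto
    have pos: "0 < snd z" if "z \<in> C" for z using subsetD[OF C(1) that] by auto
    have "\<exists>s\<in>fst ` C. dist x s < 5 / real (Suc n)" for x
    proof -
      obtain w where w: "w \<in> C" "ball x (1 / real (Suc n)) \<subseteq> ball (fst w) (5 * snd w)"
        using C(3)[of "(x, 1 / real (Suc n))"] by auto
      have "x \<in> ball x (1 / real (Suc n))" by simp
      then have "dist (fst w) x < 5 * snd w" using w(2) by (meson mem_ball subsetD)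
      moreover have "snd w = 1 / real (Suc n)" using w(1) C(1) by auto
      ultimately show ?thesis using w(1) by (intro bexI[of _ "fst w"]) (simp_all add: dist_commute)
    qed
    moreover have "countable (fst ` C)"
      by (intro countable_image countable_disjoint_balls[OF C(2) pos])
    ultimately show ?thesis by (intro exI[of _ "fst ` C"] conjI allI)
  qed
  have "\<exists>C::nat \<Rightarrow> 'a set. \<forall>n. countable (C n) \<and> (\<forall>x. \<exists>s\<in>C n. dist x s < 5 / real (Suc n))"
    by (rule choice, rule allI, rule step)
  then obtain C :: "nat \<Rightarrow> 'a set"
    where C: "\<forall>n. countable (C n) \<and> (\<forall>x. \<exists>s\<in>C n. dist x s < 5 / real (Suc n))" ..
  show ?thesis
  proof (rule that[of "\<Union>n. C n"])
    fix x :: 'a and \<epsilon> :: real assume "0 < \<epsilon>"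
    then have "0 < \<epsilon> / 5" by simp
    then obtain n where "1 / real (Suc n) < \<epsilon> / 5" by (rule nat_approx_posE)
    then have "5 / real (Suc n) < \<epsilon>" by (simp add: field_simps)
    moreover obtain s where "s \<in> C n" "dist x s < 5 / real (Suc n)" using C by blast
    ultimately show "\<exists>s\<in>\<Union>n. C n. dist x s < \<epsilon>" by (intro bexI[of _ s]) auto
  qed (use C in \<open>simp add: countable_UN\<close>)
qed

text \<open>
  In a nonseparable space the distance can fail to be measurable for the product of the Borel
  sigma-algebras; a countable dense set \<open>S\<close> reduces it to functions of one variable.
\<close>

lemma measurable_dist_pair: "(\<lambda>p. dist (fst p) (snd p)) \<in> borel_measurable (\<gamma> \<Otimes>\<^sub>M \<gamma>)"
proof (rule borel_measurableI_less)
  fix a :: real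
  obtain S :: "'a set" where S: "countable S" "\<And>x \<epsilon>. 0 < \<epsilon> \<Longrightarrow> \<exists>s\<in>S. dist x s < \<epsilon>"
    by (rule countable_dense) blast
  have m: "(\<lambda>x. dist x s) \<in> borel_measurable \<gamma>" "(\<lambda>x. dist s x) \<in> borel_measurable \<gamma>" for s
    by (simp_all add: measurable_cong_sets[OF sets_eq_borel refl] borel_measurable_continuous_onI continuous_intros)
  have "{p \<in> space (\<gamma> \<Otimes>\<^sub>M \<gamma>). dist (fst p) (snd p) < a}
      = (\<Union>s\<in>S. {p \<in> space (\<gamma> \<Otimes>\<^sub>M \<gamma>). dist (fst p) s + dist s (snd p) < a})" (is "_ = ?R")
  proof (intro equalityI subsetI)
    fix p assume p: "p \<in> {p \<in> space (\<gamma> \<Otimes>\<^sub>M \<gamma>). dist (fst p) (snd p) < a}"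
    then obtain s where s: "s \<in> S" "dist (fst p) s < (a - dist (fst p) (snd p)) / 2"
      using S(2)[of "(a - dist (fst p) (snd p)) / 2" "fst p"] by auto
    have "dist s (snd p) \<le> dist (fst p) s + dist (fst p) (snd p)" by (rule dist_triangle3)
    then have "dist (fst p) s + dist s (snd p) < a" using s by (simp add: field_simps)
    then show "p \<in> ?R" using p s(1) by auto
  next
    fix p assume "p \<in> ?R"
    then show "p \<in> {p \<in> space (\<gamma> \<Otimes>\<^sub>M \<gamma>). dist (fst p) (snd p) < a}"
      using dist_triangle[of "fst p" "snd p"] by (auto intro: le_less_trans)
  qed
  also have "\<dots> \<in> sets (\<gamma> \<Otimes>\<^sub>M \<gamma>)"
    using S(1) measurable_compose[OF measurable_fst m(1)] measurable_compose[OF measurable_snd m(2)]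
    by (intro sets.countable_UN'' borel_measurable_less borel_measurable_add) (simp_all only: borel_measurable_const)
  finally show "{p \<in> space (\<gamma> \<Otimes>\<^sub>M \<gamma>). dist (fst p) (snd p) < a} \<in> sets (\<gamma> \<Otimes>\<^sub>M \<gamma>)" .
qed

lemma measurable_dist' [measurable]:
  assumes [measurable]: "f \<in> measurable M \<gamma>" "g \<in> measurable M \<gamma>"
  shows "(\<lambda>x. dist (f x) (g x)) \<in> borel_measurable M"
  using measurable_compose[OF measurable_Pair[OF assms] measurable_dist_pair] by simp

lemma measurable_U_fst [measurable]: "fst \<in> measurable U \<gamma>"
  and measurable_U_snd [measurable]: "snd \<in> borel_measurable U"
  using sets_U by (simp_all add: measurable_cong_sets[OF sets_U refl])

lemma space_U [simp]: "space U = UNIV"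
  using sets_eq_imp_space_eq[OF sets_U] by (simp add: space_pair_measure)

text \<open>
  The ball \<open>B(y, t)\<close> lies in \<open>W\<close> iff \<open>t\<close> is at most the distance from \<open>y\<close> to the complement of
  \<open>W\<close>, which is continuous in \<open>y\<close>.
\<close>

lemma sets_ball_subset [measurable]: "{z. ball_of z \<subseteq> W} \<in> sets U"
proof (cases "W = UNIV")
  case True
  then show ?thesis using sets.top[of U] by simp
next
  case False
  then have ne: "- W \<noteq> {}" by auto
  have iff: "ball y t \<subseteq> W \<longleftrightarrow> t \<le> infdist y (- W)" for y t
  proof
    assume "ball y t \<subseteq> W"
    then show "t \<le> infdist y (- W)"
      unfolding infdist_def using ne by (auto intro!: cINF_greatest simp: subset_iff not_less)
  next
    assume t: "t \<le> infdist y (- W)"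
    show "ball y t \<subseteq> W"
    proof
      fix x assume "x \<in> ball y t"
      then have "\<not> infdist y (- W) \<le> dist y x" using t by simp
      then show "x \<in> W" using infdist_le[of x "- W" y] by blast
    qed
  qed
  then have "{z. ball_of z \<subseteq> W} = {z \<in> space U. snd z \<le> infdist (fst z) (- W)}" by simp
  also have "\<dots> \<in> sets U"
  proof -
    have "(\<lambda>y. infdist y (- W)) \<in> borel_measurable \<gamma>"
      by (simp add: measurable_cong_sets[OF sets_eq_borel refl] borel_measurable_continuous_onI continuous_on_infdist)
    from measurable_compose[OF measurable_U_fst this] show ?thesis
      by (intro borel_measurable_le measurable_U_snd)
  qed
  finally show ?thesis .
qed

section \<open>Cone integrals and the size of a density\<close>

lemma emeasure_ball_Int:
  assumes [measurable]: "S \<in> sets \<gamma>"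
  shows "emeasure \<gamma> (ball_of z \<inter> S)
    = (\<integral>\<^sup>+x. indicator {z. dist x (fst z) < snd z} z * indicator S x \<partial>\<gamma>)"
proof -
  have "emeasure \<gamma> (ball_of z \<inter> S) = (\<integral>\<^sup>+x. indicator (ball_of z \<inter> S) x \<partial>\<gamma>)"
    by (subst nn_integral_indicator) (auto intro!: sets.Int assms)
  also have "\<dots> = (\<integral>\<^sup>+x. indicator {z. dist x (fst z) < snd z} z * indicator S x \<partial>\<gamma>)"
    by (intro nn_integral_cong) (auto simp: indicator_def dist_commute)
  finally show ?thesis .
qed

lemma measurable_emeasure_ball_Int [measurable]:
  assumes [measurable]: "S \<in> sets \<gamma>"
  shows "(\<lambda>z. emeasure \<gamma> (ball_of z \<inter> S)) \<in> borel_measurable U"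
  unfolding emeasure_ball_Int[OF assms] indicator_def mem_Collect_eq by measurable

lemma measurable_emeasure_ball [measurable]:
  "(\<lambda>z. emeasure \<gamma> (ball_of z)) \<in> borel_measurable U"
  using measurable_emeasure_ball_Int[of UNIV] by (simp add: sets_eq_borel)

text \<open>
  For \<open>h = |f|\<^sup>q\<close> on \<open>D\<close> and \<open>h = 0\<close> elsewhere this is the \<open>q\<close>-th power of the area functional. The
  truncation \<open>t < m y\<close> is carried by \<open>h\<close>, so that the remaining cone \<open>dist x y < t\<close> is measurable.
\<close>

definition cone_integral :: "('a \<times> real \<Rightarrow> ennreal) \<Rightarrow> 'a \<Rightarrow> ennreal" where
  "cone_integral h x =
    (\<integral>\<^sup>+z. h z / emeasure \<gamma> (ball_of z) * indicator {z. dist x (fst z) < snd z} z \<partial>U)"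

lemma measurable_cone_kernel [measurable]:
  assumes [measurable]: "h \<in> borel_measurable U"
  shows "(\<lambda>z. h z / emeasure \<gamma> (ball_of z) * indicator {z. dist x (fst z) < snd z} z)
    \<in> borel_measurable U"
proof -
  have [measurable]: "(\<lambda>z. x) \<in> measurable U \<gamma>" by (rule measurable_const) simp
  show ?thesis unfolding indicator_def mem_Collect_eq by measurable
qed

lemma measurable_cone_integral [measurable]:
  assumes [measurable]: "h \<in> borel_measurable U"
  shows "cone_integral h \<in> borel_measurable \<gamma>"
  unfolding cone_integral_def[abs_def] indicator_def mem_Collect_eq by measurable

lemma nn_integral_cone_integral:
  assumes [measurable]: "h \<in> borel_measurable U" "S \<in> sets \<gamma>"
  shows "(\<integral>\<^sup>+x\<in>S. cone_integral h x \<partial>\<gamma>)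
    = (\<integral>\<^sup>+z. h z / emeasure \<gamma> (ball_of z) * emeasure \<gamma> (ball_of z \<inter> S) \<partial>U)"
proof -
  have "(\<integral>\<^sup>+x\<in>S. cone_integral h x \<partial>\<gamma>) = (\<integral>\<^sup>+x. \<integral>\<^sup>+z. h z / emeasure \<gamma> (ball_of z)
      * (indicator {z. dist x (fst z) < snd z} z * indicator S x) \<partial>U \<partial>\<gamma>)"
    unfolding cone_integral_def
    by (intro nn_integral_cong) (simp add: nn_integral_multc[symmetric] mult.assoc)
  also have "\<dots> = (\<integral>\<^sup>+z. \<integral>\<^sup>+x. h z / emeasure \<gamma> (ball_of z)
      * (indicator {z. dist x (fst z) < snd z} z * indicator S x) \<partial>\<gamma> \<partial>U)"
    unfolding indicator_def mem_Collect_eq by (rule \<gamma>U.Fubini'[symmetric]) measurable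
  also have "\<dots> = (\<integral>\<^sup>+z. h z / emeasure \<gamma> (ball_of z) * emeasure \<gamma> (ball_of z \<inter> S) \<partial>U)"
    unfolding emeasure_ball_Int[OF assms(2)] indicator_def mem_Collect_eq
    by (intro nn_integral_cong nn_integral_cmult) measurable
  finally show ?thesis .
qed

definition area :: "('a \<times> real \<Rightarrow> ennreal) \<Rightarrow> 'a \<Rightarrow> ennreal" where
  "area h x = ennreal_powr (cone_integral h x) (1 / q)"

definition tent_size :: "('a \<times> real \<Rightarrow> ennreal) \<Rightarrow> ennreal" where
  "tent_size h = (\<integral>\<^sup>+x. area h x \<partial>\<gamma>)"

lemma measurable_area [measurable]:
  assumes [measurable]: "h \<in> borel_measurable U"
  shows "area h \<in> borel_measurable \<gamma>"
  unfolding area_def[abs_def] by measurable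

lemma cone_integral_mono: "(\<And>z. h z \<le> h' z) \<Longrightarrow> cone_integral h x \<le> cone_integral h' x"
  unfolding cone_integral_def by (intro nn_integral_mono mult_right_mono divide_right_mono_ennreal) auto

lemma area_mono: "(\<And>z. h z \<le> h' z) \<Longrightarrow> area h x \<le> area h' x"
  unfolding area_def using q_ge_1 by (intro ennreal_powr_mono cone_integral_mono) auto

lemma tent_size_mono: "(\<And>z. h z \<le> h' z) \<Longrightarrow> tent_size h \<le> tent_size h'"
  unfolding tent_size_def by (intro nn_integral_mono area_mono)

text \<open>
  Dominated convergence twice: in the cone integral at each point where the area functional is
  finite, and then in the integral over \<open>X\<close>.
\<close>

lemma tent_size_tendsto_0:
  fixes G :: "nat \<Rightarrow> ('a \<times> real) set"
  assumes [measurable]: "h \<in> borel_measurable U" "\<And>n. G n \<in> sets U"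
    and fin: "tent_size h < \<infinity>"
    and ev: "AE z in U. h z / emeasure \<gamma> (ball_of z) \<noteq> 0 \<longrightarrow> eventually (\<lambda>n. z \<notin> G n) sequentially"
  shows "(\<lambda>n. tent_size (\<lambda>z. h z * indicator (G n) z)) \<longlonglongrightarrow> 0"
proof -
  let ?h = "\<lambda>n z. h z * indicator (G n) z"
  have le: "?h n z \<le> h z" for n z by (simp add: indicator_def)
  have "AE x in \<gamma>. area h x \<noteq> \<infinity>"
    using fin unfolding tent_size_def by (intro nn_integral_PInf_AE) auto
  then have conv: "AE x in \<gamma>. (\<lambda>n. area (?h n) x) \<longlonglongrightarrow> 0"
  proof eventually_elim
    fix x assume "area h x \<noteq> \<infinity>"
    then have J: "cone_integral h x < \<infinity>"
      using q_pos ennreal_powr_eq_top_iff[of "1 / q" "cone_integral h x"]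
      by (auto simp: area_def less_top[symmetric])
    have "(\<lambda>n. cone_integral (?h n) x) \<longlonglongrightarrow> (\<integral>\<^sup>+z. 0 \<partial>U)"
      unfolding cone_integral_def
    proof (rule nn_integral_dominated_convergence[where w = "\<lambda>z. h z / emeasure \<gamma> (ball_of z)
        * indicator {z. dist x (fst z) < snd z} z"])
      show "(\<integral>\<^sup>+z. h z / emeasure \<gamma> (ball_of z) * indicator {z. dist x (fst z) < snd z} z \<partial>U) < \<infinity>"
        using J unfolding cone_integral_def .
      show "AE z in U. ?h n z / emeasure \<gamma> (ball_of z) * indicator {z. dist x (fst z) < snd z} z
          \<le> h z / emeasure \<gamma> (ball_of z) * indicator {z. dist x (fst z) < snd z} z" for n
        using le by (intro AE_I2 mult_right_mono divide_right_mono_ennreal) auto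
      show "AE z in U. (\<lambda>n. ?h n z / emeasure \<gamma> (ball_of z) * indicator {z. dist x (fst z) < snd z} z) \<longlonglongrightarrow> 0"
        using ev
      proof eventually_elim
        fix z assume z: "h z / emeasure \<gamma> (ball_of z) \<noteq> 0 \<longrightarrow> eventually (\<lambda>n. z \<notin> G n) sequentially"
        have "eventually (\<lambda>n. ?h n z / emeasure \<gamma> (ball_of z) * indicator {z. dist x (fst z) < snd z} z = 0) sequentially"
        proof (cases "h z / emeasure \<gamma> (ball_of z) = 0")
          case False
          then show ?thesis using z by (auto elim!: eventually_mono)
        qed (auto intro!: always_eventually)
        then show "(\<lambda>n. ?h n z / emeasure \<gamma> (ball_of z) * indicator {z. dist x (fst z) < snd z} z) \<longlonglongrightarrow> 0"
          by (rule tendsto_eventually)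
      qed
    qed (unfold indicator_def mem_Collect_eq, measurable)
    then show "(\<lambda>n. area (?h n) x) \<longlonglongrightarrow> 0"
      unfolding area_def using q_pos by (intro tendsto_ennreal_powr_0) auto
  qed
  have "(\<lambda>n. tent_size (?h n)) \<longlonglongrightarrow> (\<integral>\<^sup>+x. 0 \<partial>\<gamma>)"
    unfolding tent_size_def
    by (rule nn_integral_dominated_convergence[where w = "area h"])
      (use conv fin le in \<open>auto simp: tent_size_def intro!: AE_I2 area_mono\<close>)
  then show ?thesis by simp
qed

text \<open>
  Integrate the cone integral over \<open>W - V\<close>. By Tonelli the point \<open>z\<close> enters with the factor
  \<open>\<gamma>(B \<inter> (W - V)) / \<gamma>(B)\<close>, where \<open>B\<close> is its ball, and this is at least 1/2 on \<open>F\<close>.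
\<close>

lemma nn_integral_le_cone_integral:
  assumes [measurable]: "h \<in> borel_measurable U" "F \<in> sets U" "V \<in> sets \<gamma>" "W \<in> sets \<gamma>"
    and F: "\<And>z. z \<in> F \<Longrightarrow> h z \<noteq> 0 \<Longrightarrow> 0 < snd z \<and> emeasure \<gamma> (ball_of z) \<noteq> \<infinity> \<and>
      ball_of z \<subseteq> W \<and> 2 * emeasure \<gamma> (ball_of z \<inter> V) \<le> emeasure \<gamma> (ball_of z)"
  shows "(\<integral>\<^sup>+z\<in>F. h z \<partial>U) \<le> 2 * (\<integral>\<^sup>+x\<in>W - V. cone_integral h x \<partial>\<gamma>)"
proof -
  have "h z * indicator F z
      \<le> 2 * (h z / emeasure \<gamma> (ball_of z) * emeasure \<gamma> (ball_of z \<inter> (W - V)))" for z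
  proof (cases "z \<in> F \<and> h z \<noteq> 0")
    case True
    let ?b = "emeasure \<gamma> (ball_of z)"
    have z: "0 < snd z" "?b \<noteq> \<infinity>" "ball_of z \<subseteq> W" "2 * emeasure \<gamma> (ball_of z \<inter> V) \<le> ?b"
      using F[of z] True by auto
    have eq: "ball_of z \<inter> (W - V) = ball_of z - V" using z(3) by auto
    have "emeasure \<gamma> (ball_of z \<inter> V) + emeasure \<gamma> (ball_of z - V)
        = emeasure \<gamma> ((ball_of z \<inter> V) \<union> (ball_of z - V))"
      by (intro plus_emeasure) (auto intro!: sets.Int sets.Diff assms)
    also have "(ball_of z \<inter> V) \<union> (ball_of z - V) = ball_of z" by blast
    finally have "?b \<le> 2 * emeasure \<gamma> (ball_of z - V)"
      using z by (intro le_twice_rest) auto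
    then have "h z / ?b * ?b \<le> h z / ?b * (2 * emeasure \<gamma> (ball_of z - V))"
      by (intro mult_left_mono) auto
    moreover have "h z / ?b * ?b = h z"
      using z(2) ball_pos[OF z(1), of "fst z"]
      by (simp add: ennreal_divide_times ennreal_divide_self less_top)
    ultimately show ?thesis using True eq by (simp add: ac_simps)
  qed (auto simp: indicator_def)
  then have "(\<integral>\<^sup>+z\<in>F. h z \<partial>U)
      \<le> (\<integral>\<^sup>+z. 2 * (h z / emeasure \<gamma> (ball_of z) * emeasure \<gamma> (ball_of z \<inter> (W - V))) \<partial>U)"
    by (intro nn_integral_mono)
  also have "\<dots> = 2 * (\<integral>\<^sup>+x\<in>W - V. cone_integral h x \<partial>\<gamma>)"
    by (subst nn_integral_cone_integral) (auto intro!: nn_integral_cmult)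
  finally show ?thesis .
qed

section \<open>Level sets of the area functional and heavy points\<close>

definition superlevel :: "('a \<times> real \<Rightarrow> ennreal) \<Rightarrow> int \<Rightarrow> 'a set" where
  "superlevel h i = {x. ennreal (2 powr real_of_int i) < area h x}"

text \<open>
  A ball of infinite mass is never heavy, since the strict inequality bounds its mass from above.
\<close>

definition heavy :: "('a \<times> real \<Rightarrow> ennreal) \<Rightarrow> int \<Rightarrow> ('a \<times> real) set" where
  "heavy h i = {z. emeasure \<gamma> (ball_of z) < 2 * emeasure \<gamma> (ball_of z \<inter> superlevel h i)}"

lemma superlevel_sets [measurable]:
  assumes [measurable]: "h \<in> borel_measurable U"
  shows "superlevel h i \<in> sets \<gamma>"
proof -
  have "{x \<in> space \<gamma>. ennreal (2 powr real_of_int i) < area h x} \<in> sets \<gamma>" by measurable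
  then show ?thesis by (simp add: superlevel_def)
qed

lemma superlevel_mono:
  assumes "i \<le> j"
  shows "superlevel h j \<subseteq> superlevel h i"
proof -
  have le: "ennreal (2 powr real_of_int i) \<le> ennreal (2 powr real_of_int j)"
    using assms by (intro ennreal_leI powr_mono) auto
  show ?thesis unfolding superlevel_def by (intro Collect_mono impI le_less_trans[OF le])
qed

lemma heavy_sets [measurable]:
  assumes [measurable]: "h \<in> borel_measurable U"
  shows "heavy h i \<in> sets U"
proof -
  have "{z \<in> space U. emeasure \<gamma> (ball_of z) < 2 * emeasure \<gamma> (ball_of z \<inter> superlevel h i)} \<in> sets U"
    by measurable
  then show ?thesis by (simp add: heavy_def)
qed

lemma heavy_mono:
  assumes [measurable]: "h \<in> borel_measurable U" and "i \<le> j"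
  shows "heavy h j \<subseteq> heavy h i"
proof
  fix z assume "z \<in> heavy h j"
  then have "emeasure \<gamma> (ball_of z) < 2 * emeasure \<gamma> (ball_of z \<inter> superlevel h j)"
    by (simp add: heavy_def)
  also have "\<dots> \<le> 2 * emeasure \<gamma> (ball_of z \<inter> superlevel h i)"
    by (intro mult_left_mono emeasure_mono Int_mono order_refl superlevel_mono assms
        sets.Int superlevel_sets ball_in_sets) simp
  finally show "z \<in> heavy h i" by (simp add: heavy_def)
qed

lemma superlevel_Markov:
  assumes [measurable]: "h \<in> borel_measurable U"
  shows "ennreal (2 powr real_of_int i) * emeasure \<gamma> (superlevel h i) \<le> tent_size h"
proof -
  have "ennreal (2 powr real_of_int i) * emeasure \<gamma> (superlevel h i)
      = (\<integral>\<^sup>+x. ennreal (2 powr real_of_int i) * indicator (superlevel h i) x \<partial>\<gamma>)"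
    by (rule nn_integral_cmult_indicator[symmetric]) measurable
  also have "\<dots> \<le> tent_size h"
    unfolding tent_size_def by (intro nn_integral_mono) (auto simp: indicator_def superlevel_def)
  finally show ?thesis .
qed

lemma sum_superlevel_le:
  assumes [measurable]: "h \<in> borel_measurable U"
  shows "(\<Sum>n. ennreal (2 powr real_of_int (int_decode n)) * emeasure \<gamma> (superlevel h (int_decode n)))
    \<le> 2 * tent_size h"
proof -
  have "(\<Sum>n. ennreal (2 powr real_of_int (int_decode n)) * emeasure \<gamma> (superlevel h (int_decode n)))
      = (\<Sum>n. \<integral>\<^sup>+x. ennreal (2 powr real_of_int (int_decode n)) * indicator (superlevel h (int_decode n)) x \<partial>\<gamma>)"
    by (intro suminf_cong nn_integral_cmult_indicator[symmetric]) measurable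
  also have "\<dots> = (\<integral>\<^sup>+x. (\<Sum>n. ennreal (2 powr real_of_int (int_decode n)) * indicator (superlevel h (int_decode n)) x) \<partial>\<gamma>)"
    by (rule nn_integral_suminf[symmetric]) measurable
  also have "\<dots> \<le> (\<integral>\<^sup>+x. 2 * area h x \<partial>\<gamma>)"
  proof (rule nn_integral_mono)
    fix x
    show "(\<Sum>n. ennreal (2 powr real_of_int (int_decode n)) * indicator (superlevel h (int_decode n)) x) \<le> 2 * area h x"
      using sum_dyadic_layers_le[of "area h x"] by (simp add: indicator_def superlevel_def)
  qed
  also have "\<dots> = 2 * tent_size h" unfolding tent_size_def by (rule nn_integral_cmult) measurable
  finally show ?thesis .
qed

text \<open>
  By Markov's inequality the mass of the superlevel sets tends to zero, so eventually it is less
  than half of the positive mass of the ball.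
\<close>

lemma not_all_heavy:
  assumes [measurable]: "h \<in> borel_measurable U" and fin: "tent_size h < \<infinity>"
    and z: "0 < snd z"
  shows "\<exists>i. z \<notin> heavy h i"
proof (rule ccontr)
  assume "\<not> ?thesis"
  then have all: "z \<in> heavy h i" for i by blast
  let ?b = "emeasure \<gamma> (ball_of z)"
  have b_fin: "?b \<noteq> \<infinity>" using all[of 0] by (auto simp: heavy_def)
  obtain b where b: "?b = ennreal b" "0 \<le> b" using b_fin by (cases ?b rule: ennreal_cases) auto
  have b_pos: "0 < b" using ball_pos[OF z, of "fst z"] b by (cases "b = 0") auto
  obtain t where t: "tent_size h = ennreal t" "0 \<le> t"
    using fin by (cases "tent_size h" rule: ennreal_cases) auto
  have le: "2 ^ n * b \<le> 2 * t" for n :: nat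
  proof -
    have "?b \<le> 2 * emeasure \<gamma> (ball_of z \<inter> superlevel h (int n))"
      using all[of "int n"] by (simp add: heavy_def)
    also have "\<dots> \<le> 2 * emeasure \<gamma> (superlevel h (int n))"
      by (intro mult_left_mono emeasure_mono) auto
    finally have "ennreal (2 powr real_of_int (int n)) * ?b
        \<le> ennreal (2 powr real_of_int (int n)) * (2 * emeasure \<gamma> (superlevel h (int n)))"
      by (rule mult_left_mono) simp
    also have "\<dots> = 2 * (ennreal (2 powr real_of_int (int n)) * emeasure \<gamma> (superlevel h (int n)))"
      by (simp add: ac_simps)
    also have "\<dots> \<le> 2 * tent_size h" by (intro mult_left_mono superlevel_Markov) auto
    finally have "ennreal (2 ^ n * b) \<le> ennreal (2 * t)"
      using b t by (simp add: powr_realpow ennreal_mult)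
    then show ?thesis using t by (simp add: ennreal_le_iff)
  qed
  obtain n where "2 * t / b < 2 ^ n" using real_arch_pow[of 2 "2 * t / b"] by auto
  then show False using le[of n] b_pos by (simp add: field_simps)
qed

text \<open>
  Let \<open>V\<close> be the set where the area functional is positive. A ball of finite mass that is not
  heavy at any level has at most half of its mass in \<open>V\<close>. So the integral of \<open>h\<close> over these
  points is at most twice the integral of the cone integral over the complement of \<open>V\<close>, which
  is zero.
\<close>

lemma AE_some_heavy:
  assumes [measurable]: "h \<in> borel_measurable U" and supp: "\<And>z. h z \<noteq> 0 \<Longrightarrow> 0 < snd z"
  shows "AE z in U. h z / emeasure \<gamma> (ball_of z) \<noteq> 0 \<longrightarrow> (\<exists>i. z \<in> heavy h i)"
proof -
  define V where "V = {x. 0 < area h x}"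
  have "{x \<in> space \<gamma>. 0 < area h x} \<in> sets \<gamma>" by measurable
  then have V [measurable]: "V \<in> sets \<gamma>" by (simp add: V_def)
  define G where "G = {z. emeasure \<gamma> (ball_of z) \<noteq> \<infinity>} - (\<Union>i. heavy h i)"
  have "{z \<in> space U. emeasure \<gamma> (ball_of z) \<noteq> \<infinity>} \<in> sets U" by measurable
  then have G [measurable]: "G \<in> sets U" unfolding G_def by (intro sets.Diff sets.countable_UN) auto
  have half: "2 * emeasure \<gamma> (ball_of z \<inter> V) \<le> emeasure \<gamma> (ball_of z)" if "z \<in> G" for z
  proof -
    have "incseq (\<lambda>n. ball_of z \<inter> superlevel h (- int n))"
      unfolding incseq_def by (intro allI impI Int_mono order_refl superlevel_mono) simp
    then have "emeasure \<gamma> (\<Union>n. ball_of z \<inter> superlevel h (- int n))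
        = (SUP n. emeasure \<gamma> (ball_of z \<inter> superlevel h (- int n)))"
      by (intro SUP_emeasure_incseq[symmetric]) (auto intro!: sets.Int)
    moreover have "(\<Union>n. ball_of z \<inter> superlevel h (- int n)) = ball_of z \<inter> V"
    proof -
      have "\<exists>n. x \<in> superlevel h (- int n)" if "x \<in> V" for x
      proof (cases "area h x" rule: ennreal_cases)
        case (real r)
        then have "0 < r" using that by (cases "r = 0") (auto simp: V_def)
        then obtain n where "(1/2) ^ n < r" using real_arch_pow_inv[of r "1/2"] by auto
        moreover have "2 powr real_of_int (- int n) = (1/2) ^ n"
          by (simp add: powr_minus powr_realpow power_one_over inverse_eq_divide)
        ultimately show ?thesis using real \<open>0 < r\<close> by (intro exI[of _ n]) (simp add: ennreal_lessI superlevel_def)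
      qed (auto simp: superlevel_def)
      moreover have "superlevel h i \<subseteq> V" for i unfolding V_def superlevel_def by (auto intro: le_less_trans[OF zero_le])
      ultimately show ?thesis by blast
    qed
    moreover have "2 * (SUP n. emeasure \<gamma> (ball_of z \<inter> superlevel h (- int n))) \<le> emeasure \<gamma> (ball_of z)"
      unfolding SUP_mult_left_ennreal
      using that by (intro SUP_least) (auto simp: G_def heavy_def not_less)
    ultimately show ?thesis by simp
  qed
  have "(\<integral>\<^sup>+z\<in>G. h z \<partial>U) \<le> 2 * (\<integral>\<^sup>+x\<in>UNIV - V. cone_integral h x \<partial>\<gamma>)"
  proof (rule nn_integral_le_cone_integral[OF assms(1) G V])
    show "UNIV \<in> sets \<gamma>" using sets.top[of \<gamma>] by simp
  qed (use supp half in \<open>auto simp: G_def\<close>)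
  also have "(\<integral>\<^sup>+x\<in>UNIV - V. cone_integral h x \<partial>\<gamma>) = (\<integral>\<^sup>+x. 0 \<partial>\<gamma>)"
    using q_pos
    by (intro nn_integral_cong) (auto simp: V_def indicator_def area_def ennreal_powr_eq_0_iff)
  finally have "(\<integral>\<^sup>+z\<in>G. h z \<partial>U) = 0" by simp
  then have "AE z in U. h z * indicator G z = 0" by (subst (asm) nn_integral_0_iff_AE) auto
  then show ?thesis by eventually_elim (auto simp: G_def indicator_def split: if_splits)
qed

section \<open>Partition into atomic sets\<close>

text \<open>
  For \<open>h = |f|\<^sup>q\<close> this says that the restriction of \<open>f\<close> to \<open>F\<close> is \<open>l\<close> times an atom. The
  pair \<open>F = {}\<close>, \<open>l = 0\<close> fills unused indices.
\<close>

definition atomic_set :: "('a \<times> real \<Rightarrow> ennreal) \<Rightarrow> ('a \<times> real) set \<Rightarrow> real \<Rightarrow> bool" where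
  "atomic_set h F l \<longleftrightarrow> F \<in> sets U \<and> (F = {} \<and> l = 0 \<or> 0 < l \<and>
    (\<exists>(c, r) \<in> admissible_balls m 5. (\<forall>z\<in>F. ball_of z \<subseteq> ball c r) \<and>
      emeasure \<gamma> (ball c r) \<noteq> \<infinity> \<and>
      (\<integral>\<^sup>+z\<in>F. h z \<partial>U) \<le> ennreal (l powr q * measure \<gamma> (ball c r) powr (1 - q))))"

text \<open>
  The sets need to cover only the points that the area functional sees. A point whose ball has
  infinite mass is not among them, since the quotient is then 0.
\<close>

definition atomic_partition ::
  "('a \<times> real \<Rightarrow> ennreal) \<Rightarrow> (nat \<Rightarrow> ('a \<times> real) set) \<Rightarrow> (nat \<Rightarrow> real) \<Rightarrow> bool" where
  "atomic_partition h F l \<longleftrightarrow> (\<forall>k. atomic_set h (F k) (l k)) \<and> disjoint_family F \<and>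
    (AE z in U. h z / emeasure \<gamma> (ball_of z) \<noteq> 0 \<longrightarrow> z \<in> (\<Union>k. F k))"

lemma doubling_fivefold:
  obtains K :: real where "1 \<le> K" "\<And>z. z \<in> D \<Longrightarrow>
    emeasure \<gamma> (ball (fst z) (5 * snd z)) \<le> ennreal K * emeasure \<gamma> (ball_of z)"
proof -
  have "\<exists>C::real. 1 \<le> C \<and> (\<forall>c r. 0 < r \<longrightarrow> r \<le> \<alpha> * m c \<longrightarrow>
      emeasure \<gamma> (ball c (2 * r)) \<le> ennreal C * emeasure \<gamma> (ball c r))" if "0 < \<alpha>" for \<alpha>
    using doubling that unfolding admissibly_doubling_def admissible_balls_def by fastforce
  then obtain C where C: "\<And>\<alpha>. 0 < \<alpha> \<Longrightarrow> 1 \<le> C \<alpha>"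
    "\<And>\<alpha> c r. 0 < \<alpha> \<Longrightarrow> 0 < r \<Longrightarrow> r \<le> \<alpha> * m c \<Longrightarrow>
      emeasure \<gamma> (ball c (2 * r)) \<le> ennreal (C \<alpha>) * emeasure \<gamma> (ball c r)"
    by metis
  show ?thesis
  proof (rule that[of "C 4 * (C 2 * C 1)"])
    have "1 \<le> C 2 * C 1" using mult_mono[of 1 "C 2" 1 "C 1"] C(1)[of 2] C(1)[of 1] by simp
    then show "1 \<le> C 4 * (C 2 * C 1)" using mult_mono[of 1 "C 4" 1 "C 2 * C 1"] C(1)[of 4] by simp
    fix z assume "z \<in> D"
    then have z: "0 < snd z" "snd z \<le> m (fst z)" unfolding local_half_space_def by auto
    have "emeasure \<gamma> (ball (fst z) (5 * snd z)) \<le> emeasure \<gamma> (ball (fst z) (2 * (4 * snd z)))"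
      using z by (intro emeasure_mono) auto
    also have "\<dots> \<le> C 4 * emeasure \<gamma> (ball (fst z) (2 * (2 * snd z)))"
      using C(2)[of 4 "4 * snd z" "fst z"] z by simp
    also have "\<dots> \<le> C 4 * (C 2 * emeasure \<gamma> (ball (fst z) (2 * snd z)))"
      using C(2)[of 2 "2 * snd z" "fst z"] z by (intro mult_left_mono) simp_all
    also have "\<dots> \<le> C 4 * (C 2 * (C 1 * emeasure \<gamma> (ball_of z)))"
      using C(2)[of 1 "snd z" "fst z"] z by (intro mult_left_mono) simp_all
    also have "\<dots> = ennreal (C 4 * (C 2 * C 1)) * emeasure \<gamma> (ball_of z)"
      using C(1)[of 4] C(1)[of 2] C(1)[of 1] by (simp add: ennreal_mult mult.assoc)
    finally show "emeasure \<gamma> (ball (fst z) (5 * snd z)) \<le> \<dots>" .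
  qed
qed

text \<open>
  The selected balls are disjoint, so their traces on \<open>V\<close> have total mass at most \<open>\<gamma>(V)\<close>. The
  index set \<open>N\<close> allows finitely many of them.
\<close>

lemma selected_balls:
  fixes K R :: real
  assumes [measurable]: "V \<in> sets \<gamma>"
    and K: "\<And>z. z \<in> D \<Longrightarrow>
      emeasure \<gamma> (ball (fst z) (5 * snd z)) \<le> ennreal K * emeasure \<gamma> (ball_of z)"
  obtains N :: "nat set" and w :: "nat \<Rightarrow> 'a \<times> real"
  where "\<And>n. n \<in> N \<Longrightarrow> w n \<in> D \<and> emeasure \<gamma> (ball_of (w n)) < 2 * emeasure \<gamma> (ball_of (w n) \<inter> V)"
    "\<And>z. z \<in> D \<Longrightarrow> snd z \<le> R \<Longrightarrow> emeasure \<gamma> (ball_of z) < 2 * emeasure \<gamma> (ball_of z \<inter> V) \<Longrightarrow>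
      \<exists>n\<in>N. ball_of z \<subseteq> ball (fst (w n)) (5 * snd (w n))"
    "(\<Sum>n. if n \<in> N then emeasure \<gamma> (ball (fst (w n)) (5 * snd (w n))) else 0)
      \<le> ennreal K * (2 * emeasure \<gamma> V)"
proof -
  define E where "E = {z\<in>D. snd z \<le> R \<and> emeasure \<gamma> (ball_of z) < 2 * emeasure \<gamma> (ball_of z \<inter> V)}"
  have pos: "0 < snd z" if "z \<in> E" for z using that by (auto simp: E_def local_half_space_def)
  obtain C where C: "C \<subseteq> E" "disjoint_family_on ball_of C"
    "\<And>z. z \<in> E \<Longrightarrow> \<exists>w\<in>C. ball_of z \<subseteq> ball (fst w) (5 * snd w)"
    by (rule vitali_covering_bounded_radii[of E R]) (auto simp: pos, auto simp: E_def)
  have "countable C" using C(1) pos by (intro countable_disjoint_balls[OF C(2)]) auto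
  then obtain f :: "'a \<times> real \<Rightarrow> nat" where f: "inj_on f C" by (auto simp: countable_def)
  define N where "N = f ` C"
  define w where "w = the_inv_into C f"
  have w: "w ` N = C" "inj_on w N" unfolding N_def w_def using f
    by (auto simp: the_inv_into_f_f inj_on_the_inv_into image_image)
  have wC: "w n \<in> C" if "n \<in> N" for n using that w(1) by blast
  have wE: "w n \<in> D \<and> emeasure \<gamma> (ball_of (w n)) < 2 * emeasure \<gamma> (ball_of (w n) \<inter> V)" if "n \<in> N" for n
    using wC[OF that] C(1) unfolding E_def by blast
  define B where "B n = (if n \<in> N then ball_of (w n) \<inter> V else {})" for n
  have B_sets: "range B \<subseteq> sets \<gamma>" unfolding B_def by (auto intro!: sets.Int assms)
  have "disjoint_family B"
    unfolding disjoint_family_on_def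
  proof (intro ballI impI)
    fix n k :: nat assume "n \<noteq> k"
    show "B n \<inter> B k = {}"
    proof (cases "n \<in> N \<and> k \<in> N")
      case True
      then have "ball_of (w n) \<inter> ball_of (w k) = {}"
        using \<open>n \<noteq> k\<close> inj_onD[OF w(2)] by (intro disjoint_family_onD[OF C(2) wC wC]) auto
      then show ?thesis unfolding B_def by auto
    qed (auto simp: B_def)
  qed
  then have "(\<Sum>n. emeasure \<gamma> (B n)) = emeasure \<gamma> (\<Union>n. B n)"
    using B_sets by (intro suminf_emeasure)
  also have "\<dots> \<le> emeasure \<gamma> V" by (intro emeasure_mono) (auto simp: B_def split: if_splits)
  finally have le: "(\<Sum>n. emeasure \<gamma> (B n)) \<le> emeasure \<gamma> V" .
  have "(\<Sum>n. if n \<in> N then emeasure \<gamma> (ball (fst (w n)) (5 * snd (w n))) else 0)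
      \<le> (\<Sum>n. ennreal K * (2 * emeasure \<gamma> (B n)))"
  proof (intro suminf_le)
    fix n
    show "(if n \<in> N then emeasure \<gamma> (ball (fst (w n)) (5 * snd (w n))) else 0)
        \<le> ennreal K * (2 * emeasure \<gamma> (B n))"
    proof (cases "n \<in> N")
      case True
      then have "emeasure \<gamma> (ball (fst (w n)) (5 * snd (w n))) \<le> ennreal K * emeasure \<gamma> (ball_of (w n))"
        using K wE by blast
      also have "\<dots> \<le> ennreal K * (2 * emeasure \<gamma> (B n))"
        using wE[OF True] True by (intro mult_left_mono) (auto simp: B_def)
      finally show ?thesis using True by simp
    qed simp
  qed auto
  also have "\<dots> = ennreal K * (2 * (\<Sum>n. emeasure \<gamma> (B n)))" by simp
  also have "\<dots> \<le> ennreal K * (2 * emeasure \<gamma> V)" by (intro mult_left_mono le) auto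
  finally have sum: "(\<Sum>n. if n \<in> N then emeasure \<gamma> (ball (fst (w n)) (5 * snd (w n))) else 0)
      \<le> ennreal K * (2 * emeasure \<gamma> V)" .
  show ?thesis
  proof (rule that[OF wE _ sum])
    fix z assume "z \<in> D" "snd z \<le> R" "emeasure \<gamma> (ball_of z) < 2 * emeasure \<gamma> (ball_of z \<inter> V)"
    then have "z \<in> E" unfolding E_def by blast
    then show "\<exists>n\<in>N. ball_of z \<subseteq> ball (fst (w n)) (5 * snd (w n))"
      using C(3) w(1) by blast
  qed
qed

text \<open>
  On \<open>F\<close> at most half of each ball is lost to the superlevel set of level \<open>i + 1\<close>, outside of
  which the area functional is at most \<open>2 powr (i + 1)\<close>. The factor 2 of
  \<open>nn_integral_le_cone_integral\<close> is at most \<open>2 powr q\<close>; together with the factor 2 of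
  \<open>2 powr (i + 1)\<close> this accounts for the 4.
\<close>

lemma atomic_set_heavy_diff:
  assumes [measurable]: "h \<in> borel_measurable U" "F \<in> sets U"
    and supp: "\<And>z. h z \<noteq> 0 \<Longrightarrow> 0 < snd z"
    and F: "F \<subseteq> heavy h i - heavy h (i + 1)" "\<And>z. z \<in> F \<Longrightarrow> ball_of z \<subseteq> ball c r"
    and r: "0 < r" "r \<le> 5 * m c" and fin: "emeasure \<gamma> (ball c r) \<noteq> \<infinity>"
  shows "atomic_set h F (4 * 2 powr real_of_int i * measure \<gamma> (ball c r))"
proof -
  define l where "l = 4 * 2 powr real_of_int i * measure \<gamma> (ball c r)"
  define b where "b = measure \<gamma> (ball c r)"
  have em: "emeasure \<gamma> (ball c r) = ennreal b"
    unfolding b_def using fin by (intro emeasure_eq_ennreal_measure) simp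
  have b_pos: "0 < b"
    using ball_pos[OF r(1), of c] em by (cases "b = 0") (auto simp: b_def less_le)
  define p where "p = 2 powr real_of_int i"
  have p: "0 < p" "2 powr real_of_int (i + 1) = 2 * p" by (simp_all add: p_def powr_add)
  have "(\<integral>\<^sup>+z\<in>F. h z \<partial>U) \<le> 2 * (\<integral>\<^sup>+x\<in>ball c r - superlevel h (i + 1). cone_integral h x \<partial>\<gamma>)"
  proof (rule nn_integral_le_cone_integral)
    fix z assume "z \<in> F" and nz: "h z \<noteq> 0"
    then have z: "z \<in> heavy h i" "z \<notin> heavy h (i + 1)" "ball_of z \<subseteq> ball c r"
      using F by auto
    have "emeasure \<gamma> (ball_of z) \<noteq> \<infinity>" using z(1) by (auto simp: heavy_def)
    then show "0 < snd z \<and> emeasure \<gamma> (ball_of z) \<noteq> \<infinity> \<and> ball_of z \<subseteq> ball c r \<and>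
        2 * emeasure \<gamma> (ball_of z \<inter> superlevel h (i + 1)) \<le> emeasure \<gamma> (ball_of z)"
      using z supp[OF nz] by (auto simp: heavy_def not_less)
  qed measurable
  also have "\<dots> \<le> 2 * (\<integral>\<^sup>+x. ennreal ((2 * p) powr q) * indicator (ball c r) x \<partial>\<gamma>)"
  proof (intro mult_left_mono nn_integral_mono)
    fix x
    have "cone_integral h x \<le> ennreal ((2 * p) powr q)" if "x \<notin> superlevel h (i + 1)"
      using that p q_pos ennreal_powr_leD[of "1 / q" "2 * p" "cone_integral h x"]
      by (simp add: not_less area_def superlevel_def)
    then show "cone_integral h x * indicator (ball c r - superlevel h (i + 1)) x
        \<le> ennreal ((2 * p) powr q) * indicator (ball c r) x"
      by (simp add: indicator_def)
  qed simp
  also have "\<dots> = ennreal (2 * ((2 * p) powr q * b))"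
    using b_pos by (subst nn_integral_cmult_indicator) (simp_all add: em ennreal_mult)
  also have "\<dots> \<le> ennreal (l powr q * b powr (1 - q))"
  proof (rule ennreal_leI)
    have "l = 2 * ((2 * p) * b)" by (simp add: l_def p_def b_def)
    then have "l powr q = 2 powr q * ((2 * p) powr q * b powr q)"
      using powr_mult[of 2 "(2 * p) * b" q] powr_mult[of "2 * p" b q] p b_pos by (simp only:)
    moreover have "b powr q * b powr (1 - q) = b" using b_pos by (simp add: powr_add[symmetric])
    ultimately have eq: "l powr q * b powr (1 - q) = 2 powr q * ((2 * p) powr q * b)"
      by (simp only: mult.assoc)
    have "2 powr 1 \<le> (2::real) powr q" using q_ge_1 by (intro powr_mono) auto
    then have "2 * ((2 * p) powr q * b) \<le> 2 powr q * ((2 * p) powr q * b)"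
      using b_pos by (intro mult_right_mono) auto
    then show "2 * ((2 * p) powr q * b) \<le> l powr q * b powr (1 - q)" using eq by simp
  qed
  finally have bound: "(\<integral>\<^sup>+z\<in>F. h z \<partial>U) \<le> ennreal (l powr q * b powr (1 - q))" .
  have "0 < l" using b_pos by (simp add: l_def b_def)
  moreover have "(c, r) \<in> admissible_balls m 5" using r by (simp add: admissible_balls_def)
  ultimately show ?thesis
    using bound F(2) fin assms(2) unfolding atomic_set_def b_def l_def[symmetric]
    by (intro conjI disjI2) (auto intro!: bexI[of _ "(c, r)"])
qed

text \<open>
  The level \<open>i\<close> contributes the points heavy at level \<open>i\<close> but not at level \<open>i + 1\<close>, distributed
  over the selected balls of level \<open>i\<close> by the first fivefold ball that contains the ball of
  the point.
\<close>

lemma atomic_partition_bounded: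
  assumes [measurable]: "h \<in> borel_measurable U"
    and supp: "\<And>z. h z \<noteq> 0 \<Longrightarrow> z \<in> D \<and> snd z \<le> R"
    and fin: "tent_size h < \<infinity>"
    and K: "0 \<le> K" "\<And>z. z \<in> D \<Longrightarrow>
      emeasure \<gamma> (ball (fst z) (5 * snd z)) \<le> ennreal K * emeasure \<gamma> (ball_of z)"
  shows "\<exists>F l. atomic_partition (h :: 'a \<times> real \<Rightarrow> ennreal) F l \<and>
    (\<Sum>k. ennreal (l k)) \<le> ennreal (16 * K) * tent_size h"
proof -
  define five where "five w = ball (fst w) (5 * snd w)" for w :: "'a \<times> real"
  have five_sets [measurable]: "five w \<in> sets \<gamma>" for w unfolding five_def by simp
  define P where "P i N w \<longleftrightarrow> (\<forall>n\<in>N. w n \<in> D \<and> w n \<in> heavy h i) \<and>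
    (\<forall>z. z \<in> D \<longrightarrow> snd z \<le> R \<longrightarrow> z \<in> heavy h i \<longrightarrow> (\<exists>n\<in>N. ball_of z \<subseteq> five (w n))) \<and>
    (\<Sum>n. if n \<in> N then emeasure \<gamma> (five (w n)) else 0) \<le> ennreal K * (2 * emeasure \<gamma> (superlevel h i))"
    for i :: int and N :: "nat set" and w
  have "\<exists>N w. P i N w" for i
  proof -
    obtain N w where
      1: "\<And>n. n \<in> N \<Longrightarrow> w n \<in> D \<and> emeasure \<gamma> (ball_of (w n)) < 2 * emeasure \<gamma> (ball_of (w n) \<inter> superlevel h i)" and
      2: "\<And>z. z \<in> D \<Longrightarrow> snd z \<le> R \<Longrightarrow> emeasure \<gamma> (ball_of z) < 2 * emeasure \<gamma> (ball_of z \<inter> superlevel h i) \<Longrightarrow>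
        \<exists>n\<in>N. ball_of z \<subseteq> ball (fst (w n)) (5 * snd (w n))" and
      3: "(\<Sum>n. if n \<in> N then emeasure \<gamma> (ball (fst (w n)) (5 * snd (w n))) else 0)
        \<le> ennreal K * (2 * emeasure \<gamma> (superlevel h i))"
      by (rule selected_balls[where V = "superlevel h i" and R = R and K = K])
        (use K(2) superlevel_sets[OF assms(1)] in auto)
    have "P i N w"
      unfolding P_def heavy_def five_def mem_Collect_eq
      by (intro conjI ballI allI impI 1 2 3)
    then show ?thesis by blast
  qed
  then obtain N w where Nw: "\<And>i. P i (N i) (w i)" by metis
  define W where "W i n = five (w i n)" for i n
  have W_sets [measurable]: "W i n \<in> sets \<gamma>" for i n unfolding W_def by simp
  have wD: "w i n \<in> D" and w_heavy: "w i n \<in> heavy h i" if "n \<in> N i" for i n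
    using Nw[of i] that unfolding P_def by blast+
  have W_cover: "\<exists>n\<in>N i. ball_of z \<subseteq> W i n" if "z \<in> D" "snd z \<le> R" "z \<in> heavy h i" for z i
    using Nw[of i] that unfolding P_def W_def by blast
  have W_sum: "(\<Sum>n. if n \<in> N i then emeasure \<gamma> (W i n) else 0)
      \<le> ennreal K * (2 * emeasure \<gamma> (superlevel h i))" for i
    using Nw[of i] unfolding P_def W_def by blast
  have W_fin: "emeasure \<gamma> (W i n) \<noteq> \<infinity>" if "n \<in> N i" for i n
  proof -
    have "emeasure \<gamma> (ball_of (w i n)) < \<infinity>"
      using w_heavy[OF that] unfolding heavy_def by (auto intro: less_le_trans)
    then have "ennreal K * emeasure \<gamma> (ball_of (w i n)) < \<infinity>" by (simp add: ennreal_mult_less_top)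
    then show ?thesis using le_less_trans[OF K(2)[OF wD[OF that]]] unfolding W_def five_def by auto
  qed
  define F where "F i n = (if n \<in> N i then (heavy h i - heavy h (i + 1)) \<inter> {z. ball_of z \<subseteq> W i n}
      - (\<Union>k\<in>{..<n} \<inter> N i. {z. ball_of z \<subseteq> W i k}) else {})" for i n
  define l where "l i n = (if n \<in> N i then 4 * 2 powr real_of_int i * measure \<gamma> (W i n) else 0)" for i n
  have atomic: "atomic_set h (F i n) (l i n)" for i n
  proof (cases "n \<in> N i")
    case False
    then show ?thesis by (simp add: atomic_set_def F_def l_def)
  next
    case True
    have W: "W i n = ball (fst (w i n)) (5 * snd (w i n))" by (simp add: W_def five_def)
    have "F i n \<in> sets U" unfolding F_def by (auto intro!: sets.Diff sets.Int sets.finite_UN)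
    moreover have "F i n \<subseteq> heavy h i - heavy h (i + 1)" "\<And>z. z \<in> F i n \<Longrightarrow> ball_of z \<subseteq> W i n"
      using True unfolding F_def by auto
    moreover have "0 < snd (w i n)" "snd (w i n) < m (fst (w i n))"
      using wD[OF True] by (auto simp: local_half_space_def)
    moreover have "0 < snd z" if "h z \<noteq> 0" for z
      using supp[OF that] by (auto simp: local_half_space_def)
    ultimately show ?thesis
      using True W_fin[OF True] atomic_set_heavy_diff[OF assms(1), of "F i n" i] unfolding l_def W by simp
  qed
  have sum_i: "(\<Sum>n. ennreal (l i n))
      \<le> ennreal (8 * K) * (ennreal (2 powr real_of_int i) * emeasure \<gamma> (superlevel h i))" for i
  proof -
    have "ennreal (l i n) = ennreal (4 * 2 powr real_of_int i) * (if n \<in> N i then emeasure \<gamma> (W i n) else 0)" for n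
      using W_fin[of n i] by (simp add: l_def emeasure_eq_ennreal_measure ennreal_mult)
    then have "(\<Sum>n. ennreal (l i n))
        = ennreal (4 * 2 powr real_of_int i) * (\<Sum>n. if n \<in> N i then emeasure \<gamma> (W i n) else 0)" by simp
    also have "\<dots> \<le> ennreal (4 * 2 powr real_of_int i) * (ennreal K * (2 * emeasure \<gamma> (superlevel h i)))"
      by (intro mult_left_mono W_sum) simp
    also have "\<dots> = ennreal (4 * 2 powr real_of_int i * K * 2) * emeasure \<gamma> (superlevel h i)"
    proof -
      have "ennreal (4 * 2 powr real_of_int i * K * 2) = ennreal (4 * 2 powr real_of_int i * K) * ennreal 2"
        using K(1) by (intro ennreal_mult) auto
      also have "ennreal (4 * 2 powr real_of_int i * K) = ennreal (4 * 2 powr real_of_int i) * ennreal K"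
        using K(1) by (intro ennreal_mult) auto
      finally show ?thesis by (simp only: mult.assoc ennreal_numeral)
    qed
    also have "4 * 2 powr real_of_int i * K * 2 = (8 * K) * 2 powr real_of_int i" by simp
    also have "ennreal \<dots> = ennreal (8 * K) * ennreal (2 powr real_of_int i)"
      using K(1) by (intro ennreal_mult) auto
    finally have "(\<Sum>n. ennreal (l i n))
        \<le> ennreal (8 * K) * ennreal (2 powr real_of_int i) * emeasure \<gamma> (superlevel h i)" .
    then show ?thesis by (simp only: mult.assoc)
  qed
  \<comment> \<open>The pairs (level, index of a selected ball) are enumerated by \<open>prod_decode\<close>.\<close>
  define F' where "F' k = (case prod_decode k of (a, n) \<Rightarrow> F (int_decode a) n)" for k
  define l' where "l' k = (case prod_decode k of (a, n) \<Rightarrow> l (int_decode a) n)" for k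
  have "(\<Sum>k. ennreal (l' k)) = (\<Sum>a. \<Sum>n. ennreal (l (int_decode a) n))"
    unfolding l'_def using suminf_ennreal_2dimen[of "\<lambda>a. \<Sum>n. ennreal (l (int_decode a) n)"
      "\<lambda>(a, n). ennreal (l (int_decode a) n)"] by (simp add: case_prod_unfold)
  also have "\<dots> \<le> (\<Sum>a. ennreal (8 * K) * (ennreal (2 powr real_of_int (int_decode a))
      * emeasure \<gamma> (superlevel h (int_decode a))))"
    by (intro suminf_le sum_i) auto
  also have "\<dots> = ennreal (8 * K) * (\<Sum>a. ennreal (2 powr real_of_int (int_decode a))
      * emeasure \<gamma> (superlevel h (int_decode a)))" by (rule ennreal_suminf_cmult)
  also have "\<dots> \<le> ennreal (8 * K) * (2 * tent_size h)"
    by (intro mult_left_mono sum_superlevel_le) auto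
  also have "\<dots> = ennreal (16 * K) * tent_size h"
    using K(1) by (simp add: mult.assoc[symmetric] ennreal_mult[symmetric] flip: ennreal_numeral)
  finally have sum: "(\<Sum>k. ennreal (l' k)) \<le> ennreal (16 * K) * tent_size h" .
  have disj_lt: "F i n \<inter> F j k = {}" if "i < j" for i j n k
    using heavy_mono[OF assms(1), of "i + 1" j] that unfolding F_def by auto
  have disj_n: "F i n \<inter> F i k = {}" if "n < k" for i n k
    using that unfolding F_def by auto
  have disj: "F i n \<inter> F j k = {}" if "(i, n) \<noteq> (j, k)" for i j n k
  proof -
    have "i < j \<or> j < i \<or> i = j \<and> (n < k \<or> k < n)" using that by auto
    then show ?thesis
      using disj_lt[of i j n k] disj_lt[of j i k n] disj_n[of n k i] disj_n[of k n i]
      by (metis Int_commute)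
  qed
  have "disjoint_family F'"
    unfolding disjoint_family_on_def
  proof (intro ballI impI)
    fix k k' :: nat assume ne: "k \<noteq> k'"
    obtain a n a' n' where d: "prod_decode k = (a, n)" "prod_decode k' = (a', n')" by fastforce
    have "(a, n) \<noteq> (a', n')" using ne d by (metis prod_decode_inverse)
    then have "(int_decode a, n) \<noteq> (int_decode a', n')" by (metis int_decode_inverse prod.inject)
    then show "F' k \<inter> F' k' = {}" unfolding F'_def d by (simp add: disj)
  qed
  moreover have "atomic_set h (F' k) (l' k)" for k
    unfolding F'_def l'_def by (simp add: case_prod_unfold atomic)
  moreover have "AE z in U. h z / emeasure \<gamma> (ball_of z) \<noteq> 0 \<longrightarrow> z \<in> (\<Union>k. F' k)"
  proof -
    have "AE z in U. h z / emeasure \<gamma> (ball_of z) \<noteq> 0 \<longrightarrow> (\<exists>i. z \<in> heavy h i)"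
      using supp by (intro AE_some_heavy) (auto simp: local_half_space_def)
    then show ?thesis
    proof (eventually_elim, intro impI)
      fix z assume "h z / emeasure \<gamma> (ball_of z) \<noteq> 0 \<longrightarrow> (\<exists>i. z \<in> heavy h i)"
        and nz: "h z / emeasure \<gamma> (ball_of z) \<noteq> 0"
      then obtain i where i: "z \<in> heavy h i" by blast
      have "h z \<noteq> 0" using nz by auto
      then have zD: "z \<in> D" "snd z \<le> R" using supp by blast+
      obtain j where j: "z \<notin> heavy h j"
        using not_all_heavy[OF assms(1) fin, of z] zD by (auto simp: local_half_space_def)
      have "\<exists>i. z \<in> heavy h i \<and> z \<notin> heavy h (i + 1)"
      proof (rule ccontr)
        assume "\<not> ?thesis"
        then have step: "z \<in> heavy h k \<Longrightarrow> z \<in> heavy h (k + 1)" for k by blast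
        have "z \<in> heavy h k" if "i \<le> k" for k using that
          by (induction rule: int_ge_induct) (use i step in auto)
        moreover have "z \<in> heavy h k" if "k \<le> i" for k
          using heavy_mono[OF assms(1) that] i by blast
        ultimately show False using j by (metis linear)
      qed
      then obtain i where i: "z \<in> heavy h i" "z \<notin> heavy h (i + 1)" by blast
      define n where "n = (LEAST n. n \<in> N i \<and> ball_of z \<subseteq> W i n)"
      have "\<exists>n. n \<in> N i \<and> ball_of z \<subseteq> W i n" using W_cover[OF zD i(1)] by blast
      then have n: "n \<in> N i" "ball_of z \<subseteq> W i n"
        using LeastI_ex[of "\<lambda>n. n \<in> N i \<and> ball_of z \<subseteq> W i n"] unfolding n_def by blast+
      have "\<not> ball_of z \<subseteq> W i k" if "k < n" "k \<in> N i" for k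
        using not_less_Least[of k "\<lambda>n. n \<in> N i \<and> ball_of z \<subseteq> W i n"] that unfolding n_def by blast
      then have "z \<in> F i n" using n i unfolding F_def by auto
      then have "z \<in> F' (prod_encode (int_encode i, n))" by (simp add: F'_def)
      then show "z \<in> (\<Union>k. F' k)" by blast
    qed
  qed
  ultimately have "atomic_partition h F' l'" unfolding atomic_partition_def by blast
  with sum show ?thesis by blast
qed

text \<open>
  The bands are chosen with \<open>R j \<ge> t j\<close> for \<open>j > 0\<close>, where the part of \<open>h\<close> above height \<open>t j\<close> has
  size at most \<open>(1/2) ^ j\<close> times the size of \<open>h\<close>. Summing the bounds for the bands
  costs a factor 2.
\<close>

lemma atomic_partition_exists:
  assumes [measurable]: "h \<in> borel_measurable U"
    and supp: "\<And>z. h z \<noteq> 0 \<Longrightarrow> z \<in> D"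
    and fin: "tent_size h < \<infinity>"
    and K: "0 \<le> K" "\<And>z. z \<in> D \<Longrightarrow>
      emeasure \<gamma> (ball (fst z) (5 * snd z)) \<le> ennreal K * emeasure \<gamma> (ball_of z)"
  shows "\<exists>F l. atomic_partition (h :: 'a \<times> real \<Rightarrow> ennreal) F l \<and>
    (\<Sum>k. ennreal (l k)) \<le> ennreal (32 * K) * tent_size h"
proof -
  define tail where "tail n z = h z * indicator {z. real n < snd z} z" for n :: nat and z :: "'a \<times> real"
  have half_space [measurable]: "{z. c < snd z} \<in> sets U" for c :: real
  proof -
    have "{z \<in> space U. c < snd z} \<in> sets U" by measurable
    then show ?thesis by simp
  qed
  have "(\<lambda>n. tent_size (\<lambda>z. h z * indicator {z. real n < snd z} z)) \<longlonglongrightarrow> 0"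
  proof (rule tent_size_tendsto_0[OF assms(1) _ fin])
    show "AE z in U. h z / emeasure \<gamma> (ball_of z) \<noteq> 0 \<longrightarrow>
        eventually (\<lambda>n. z \<notin> {z. real n < snd z}) sequentially"
    proof (intro AE_I2 impI)
      fix z :: "'a \<times> real"
      obtain n where "snd z \<le> real n" using real_arch_simple by blast
      then show "eventually (\<lambda>n. z \<notin> {z. real n < snd z}) sequentially"
        by (intro eventually_sequentiallyI[of n]) auto
    qed
  qed measurable
  then have lim: "(\<lambda>n. tent_size (tail n)) \<longlonglongrightarrow> 0" by (simp add: tail_def[abs_def])
  have "\<exists>n. tent_size (tail n) \<le> ennreal ((1/2) ^ j) * tent_size h" for j :: nat
  proof (cases "tent_size h = 0")
    case True
    have "tent_size (tail 0) \<le> tent_size h"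
      by (intro tent_size_mono) (simp add: tail_def indicator_def)
    then show ?thesis using True by (intro exI[of _ 0]) simp
  next
    case False
    then have "0 < tent_size h" by (rule zero_less_iff_neq_zero[THEN iffD2])
    moreover have "0 < ennreal ((1/2) ^ j)" by (subst ennreal_less_zero_iff) (rule zero_less_power, simp)
    ultimately have "0 < ennreal ((1/2) ^ j) * tent_size h"
      by (intro ennreal_zero_less_mult_iff[THEN iffD2] conjI)
    then have "eventually (\<lambda>n. tent_size (tail n) < ennreal ((1/2) ^ j) * tent_size h) sequentially"
      by (rule order_tendstoD(2)[OF lim])
    then obtain n where "tent_size (tail n) < ennreal ((1/2) ^ j) * tent_size h"
      unfolding eventually_sequentially by (meson order_refl)
    then show ?thesis by (intro exI[of _ n] less_imp_le)
  qed
  then obtain t :: "nat \<Rightarrow> nat"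
    where t: "\<And>j. tent_size (tail (t j)) \<le> ennreal ((1/2) ^ j) * tent_size h" by metis
  \<comment> \<open>\<open>R 0 = 0\<close> makes the bands start at the boundary, and the \<open>Suc\<close> forces \<open>R j \<ge> j\<close>, so that
    they exhaust all heights.\<close>
  define R where "R j = (\<Sum>i<j. Suc (t (Suc i)))" for j
  have R_Suc: "R (Suc j) = R j + Suc (t (Suc j))" for j by (simp add: R_def)
  have R_mono: "R i \<le> R j" if "i \<le> j" for i j
    by (rule lift_Suc_mono_le[OF _ that]) (simp add: R_Suc)
  have R_ge: "j \<le> R j" for j by (induction j) (auto simp: R_Suc)
  have t_R: "t j \<le> R j" if "0 < j" for j using that by (cases j) (auto simp: R_Suc)
  define band where "band j = {z :: 'a \<times> real. real (R j) < snd z \<and> snd z \<le> real (R (Suc j))}" for j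
  have band_sets [measurable]: "band j \<in> sets U" for j
  proof -
    have "{z \<in> space U. real (R j) < snd z \<and> snd z \<le> real (R (Suc j))} \<in> sets U" by measurable
    then show ?thesis by (simp add: band_def)
  qed
  have band_disj: "band i \<inter> band j = {}" if "i < j" for i j
    using R_mono[of "Suc i" j] that by (auto simp: band_def)
  have band_cover: "\<exists>j. z \<in> band j" if "0 < snd z" for z
  proof -
    obtain n where "snd z \<le> real n" using real_arch_simple by blast
    then have ex: "\<exists>j. snd z \<le> real (R j)" using R_ge[of n] by (intro exI[of _ n]) linarith
    define j where "j = (LEAST j. snd z \<le> real (R j))"
    have j: "snd z \<le> real (R j)" unfolding j_def using ex by (rule LeastI_ex)
    have "j \<noteq> 0" using that j by (cases "j = 0") (simp_all add: R_def)
    then obtain i where i: "j = Suc i" by (cases j) auto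
    have "\<not> snd z \<le> real (R i)"
      using not_less_Least[of i "\<lambda>j. snd z \<le> real (R j)"] i unfolding j_def by simp
    then show ?thesis using j i by (intro exI[of _ i]) (simp add: band_def)
  qed
  define hb where "hb j z = h z * indicator (band j) z" for j z
  have hb_meas [measurable]: "hb j \<in> borel_measurable U" for j unfolding hb_def[abs_def] by measurable
  have hb_size: "tent_size (hb j) \<le> ennreal ((1/2) ^ j) * tent_size h" for j
  proof (cases "j = 0")
    case True
    have "tent_size (hb j) \<le> tent_size h"
      by (intro tent_size_mono) (simp add: hb_def indicator_def)
    then show ?thesis using True by simp
  next
    case False
    have "tent_size (hb j) \<le> tent_size (tail (t j))"
      using t_R[of j] False
      by (intro tent_size_mono) (auto simp: hb_def tail_def band_def indicator_def)
    then show ?thesis using t[of j] by (rule order_trans)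
  qed
  have "\<exists>F l. atomic_partition (hb j) F l \<and> (\<Sum>k. ennreal (l k)) \<le> ennreal (16 * K) * tent_size (hb j)" for j
  proof (rule atomic_partition_bounded[where R = "real (R (Suc j))"])
    show "z \<in> D \<and> snd z \<le> real (R (Suc j))" if "hb j z \<noteq> 0" for z
      using that supp[of z] by (auto simp: hb_def band_def indicator_def split: if_splits)
    have "tent_size (hb j) \<le> tent_size h"
      by (intro tent_size_mono) (simp add: hb_def indicator_def)
    then show "tent_size (hb j) < \<infinity>" using fin by (rule le_less_trans)
  qed (use K in auto)
  then obtain F l where Fl: "\<And>j. atomic_partition (hb j) (F j) (l j)"
    and l_sum: "\<And>j. (\<Sum>k. ennreal (l j k)) \<le> ennreal (16 * K) * tent_size (hb j)" by metis
  define F' where "F' n = (case prod_decode n of (j, k) \<Rightarrow> F j k \<inter> band j)" for n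
  define l' where "l' n = (case prod_decode n of (j, k) \<Rightarrow> l j k)" for n
  have "(\<Sum>n. ennreal (l' n)) = (\<Sum>j. \<Sum>k. ennreal (l j k))"
    unfolding l'_def using suminf_ennreal_2dimen[of "\<lambda>j. \<Sum>k. ennreal (l j k)"
      "\<lambda>(j, k). ennreal (l j k)"] by (simp add: case_prod_unfold)
  also have "\<dots> \<le> (\<Sum>j. ennreal (16 * K) * (ennreal ((1/2) ^ j) * tent_size h))"
    by (intro suminf_le order_trans[OF l_sum] mult_left_mono hb_size) auto
  also have "\<dots> = ennreal (16 * K) * ((\<Sum>j. ennreal ((1/2) ^ j)) * tent_size h)" by simp
  also have "(\<Sum>j. ennreal ((1/2) ^ j)) = ennreal 2"
    using geometric_sums[of "1/2 :: real"] by (intro suminf_ennreal_eq) auto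
  also have "ennreal (16 * K) * (ennreal 2 * tent_size h) = ennreal (16 * K * 2) * tent_size h"
    using K(1) ennreal_mult[of "16 * K" 2] by (simp only: mult.assoc)
  also have "16 * K * 2 = 32 * K" by simp
  finally have sum: "(\<Sum>n. ennreal (l' n)) \<le> ennreal (32 * K) * tent_size h" .
  have atomic: "atomic_set h (F j k \<inter> band j) (l j k)" for j k
  proof -
    have a: "atomic_set (hb j) (F j k) (l j k)" using Fl[of j] by (simp add: atomic_partition_def)
    have "(\<integral>\<^sup>+z\<in>F j k \<inter> band j. h z \<partial>U) = (\<integral>\<^sup>+z\<in>F j k. hb j z \<partial>U)"
      by (intro nn_integral_cong) (simp add: hb_def indicator_def)
    then show ?thesis using a band_sets[of j] unfolding atomic_set_def by (auto; fastforce)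
  qed
  have "disjoint_family F'"
    unfolding disjoint_family_on_def
  proof (intro ballI impI)
    fix n n' :: nat assume ne: "n \<noteq> n'"
    obtain j k j' k' where d: "prod_decode n = (j, k)" "prod_decode n' = (j', k')" by fastforce
    show "F' n \<inter> F' n' = {}"
    proof (cases "j = j'")
      case True
      then have "k \<noteq> k'" using ne d by (metis prod_decode_inverse)
      moreover have "disjoint_family (F j)" using Fl[of j] by (simp add: atomic_partition_def)
      ultimately have "F j k \<inter> F j k' = {}" by (auto simp: disjoint_family_on_def)
      then show ?thesis unfolding F'_def d True by auto
    next
      case False
      then have "band j \<inter> band j' = {}"
        using band_disj[of j j'] band_disj[of j' j] by (cases "j < j'") (auto simp: Int_commute)
      then show ?thesis unfolding F'_def d by auto
    qed
  qed
  moreover have "atomic_set h (F' n) (l' n)" for n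
    unfolding F'_def l'_def by (simp add: case_prod_unfold atomic)
  moreover have "AE z in U. h z / emeasure \<gamma> (ball_of z) \<noteq> 0 \<longrightarrow> z \<in> (\<Union>n. F' n)"
  proof -
    have "AE z in U. \<forall>j. hb j z / emeasure \<gamma> (ball_of z) \<noteq> 0 \<longrightarrow> z \<in> (\<Union>k. F j k)"
      using Fl by (subst AE_all_countable) (simp add: atomic_partition_def)
    then show ?thesis
    proof (eventually_elim, intro impI)
      fix z assume *: "\<forall>j. hb j z / emeasure \<gamma> (ball_of z) \<noteq> 0 \<longrightarrow> z \<in> (\<Union>k. F j k)"
        and nz: "h z / emeasure \<gamma> (ball_of z) \<noteq> 0"
      have "h z \<noteq> 0" using nz by auto
      then have "0 < snd z" using supp[of z] by (auto simp: local_half_space_def)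
      then obtain j where j: "z \<in> band j" using band_cover by blast
      then have "hb j z = h z" by (simp add: hb_def)
      then obtain k where "z \<in> F j k" using *[rule_format, of j] nz by auto
      then have "z \<in> F' (prod_encode (j, k))" using j by (simp add: F'_def)
      then show "z \<in> (\<Union>n. F' n)" by blast
    qed
  qed
  ultimately have "atomic_partition h F' l'" unfolding atomic_partition_def by blast
  with sum show ?thesis by blast
qed

section \<open>The size is controlled by the coefficients\<close>

text \<open>
  With \<open>b\<close> the mass of the ball and \<open>s = l / b\<close>, the cone integral of the restriction vanishes
  outside the ball and has total integral at most \<open>s powr q * b\<close>. So
  \<open>A \<le> s * (1 + A\<^sup>q / s powr q)\<close> for the area functional \<open>A\<close> integrates to at most \<open>2 * s * b = 2 * l\<close>.
\<close>

lemma tent_size_atomic_set: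
  assumes h [measurable]: "h \<in> borel_measurable U" and "atomic_set h F l"
  shows "tent_size (\<lambda>z. h z * indicator F z) \<le> 2 * ennreal l"
proof (cases "F = {}")
  case True
  have "tent_size (\<lambda>z. h z * indicator F z) = 0"
    using True q_pos by (simp add: tent_size_def area_def cone_integral_def)
  then show ?thesis by simp
next
  case False
  let ?h = "\<lambda>z. h z * indicator F z"
  obtain c r where F [measurable]: "F \<in> sets U" and l: "0 < l" and adm: "(c, r) \<in> admissible_balls m 5"
    and sub: "\<And>z. z \<in> F \<Longrightarrow> ball_of z \<subseteq> ball c r" and fin: "emeasure \<gamma> (ball c r) \<noteq> \<infinity>"
    and bound: "(\<integral>\<^sup>+z\<in>F. h z \<partial>U) \<le> ennreal (l powr q * measure \<gamma> (ball c r) powr (1 - q))"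
    using assms(2) False unfolding atomic_set_def by blast
  have r: "0 < r" using adm by (simp add: admissible_balls_def)
  define b where "b = measure \<gamma> (ball c r)"
  have em: "emeasure \<gamma> (ball c r) = ennreal b"
    unfolding b_def using fin by (intro emeasure_eq_ennreal_measure) simp
  have b: "0 < b" using ball_pos[OF r, of c] em by (cases "b = 0") (auto simp: b_def less_le)
  define s where "s = l / b"
  have s: "0 < s" using l b by (simp add: s_def)
  have outside: "cone_integral ?h x = 0" if "x \<notin> ball c r" for x
  proof -
    have "\<not> (z \<in> F \<and> dist x (fst z) < snd z)" for z
    proof
      assume z: "z \<in> F \<and> dist x (fst z) < snd z"
      then have "x \<in> ball_of z" by (simp add: dist_commute)
      then show False using subsetD[OF sub] z that by blast
    qed
    then have "(\<lambda>z. ?h z / emeasure \<gamma> (ball_of z) * indicator {z. dist x (fst z) < snd z} z) = (\<lambda>z. 0)"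
      by (auto simp: indicator_def)
    then show ?thesis unfolding cone_integral_def by simp
  qed
  have total: "(\<integral>\<^sup>+x. cone_integral ?h x \<partial>\<gamma>) \<le> ennreal (s powr q * b)"
  proof -
    have "(\<integral>\<^sup>+x. cone_integral ?h x \<partial>\<gamma>) = (\<integral>\<^sup>+x\<in>UNIV. cone_integral ?h x \<partial>\<gamma>)" by simp
    also have "\<dots> = (\<integral>\<^sup>+z. ?h z / emeasure \<gamma> (ball_of z) * emeasure \<gamma> (ball_of z \<inter> UNIV) \<partial>U)"
      using sets.top[of \<gamma>] by (intro nn_integral_cone_integral) auto
    also have "\<dots> \<le> (\<integral>\<^sup>+z. ?h z \<partial>U)"
    proof (rule nn_integral_mono)
      fix z
      let ?b = "emeasure \<gamma> (ball_of z)"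
      have "?h z / ?b * ?b \<le> ?h z"
        by (cases "?b = 0 \<or> ?b = top") (auto simp: ennreal_divide_times ennreal_divide_self less_top)
      then show "?h z / ?b * emeasure \<gamma> (ball_of z \<inter> UNIV) \<le> ?h z" by simp
    qed
    also have "\<dots> \<le> ennreal (l powr q * b powr (1 - q))" using bound by (simp add: b_def)
    also have "l powr q * b powr (1 - q) = s powr q * b"
      using l b by (simp add: s_def powr_divide powr_diff)
    finally show ?thesis .
  qed
  have "area ?h x \<le> ennreal s * (indicator (ball c r) x + ennreal (1 / s powr q) * cone_integral ?h x)" for x
    using outside[of x] ennreal_powr_le_affine[OF q_ge_1 s, of "cone_integral ?h x"] q_pos
    by (cases "x \<in> ball c r") (simp_all add: area_def)
  then have "tent_size ?h
      \<le> (\<integral>\<^sup>+x. ennreal s * (indicator (ball c r) x + ennreal (1 / s powr q) * cone_integral ?h x) \<partial>\<gamma>)"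
    unfolding tent_size_def by (intro nn_integral_mono)
  also have "\<dots> = ennreal s * (emeasure \<gamma> (ball c r) + ennreal (1 / s powr q) * (\<integral>\<^sup>+x. cone_integral ?h x \<partial>\<gamma>))"
    by (simp add: nn_integral_cmult nn_integral_add)
  also have "\<dots> \<le> ennreal s * (ennreal b + ennreal (1 / s powr q) * ennreal (s powr q * b))"
    unfolding em by (intro mult_left_mono add_left_mono total) auto
  also have "\<dots> = ennreal (s * (b + 1 / s powr q * (s powr q * b)))"
    using s b by (simp add: ennreal_mult[symmetric] ennreal_plus[symmetric] del: ennreal_plus)
  also have "s * (b + 1 / s powr q * (s powr q * b)) = 2 * l" using s b by (simp add: s_def)
  finally show ?thesis using l by (simp add: ennreal_mult)
qed

lemma tent_size_le_sum_atomic_sets: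
  assumes h [measurable]: "h \<in> borel_measurable U" and part: "atomic_partition h F l"
  shows "tent_size h \<le> 2 * (\<Sum>k. ennreal (l k))"
proof -
  have F [measurable]: "F k \<in> sets U" for k
    using part by (simp add: atomic_partition_def atomic_set_def)
  have disj: "disjoint_family F" using part by (simp add: atomic_partition_def)
  let ?h = "\<lambda>k z. h z * indicator (F k) z"
  have split: "cone_integral h x = (\<Sum>k. cone_integral (?h k) x)" for x
  proof -
    let ?i = "\<lambda>z. indicator {z. dist x (fst z) < snd z} z :: ennreal"
    have "AE z in U. h z / emeasure \<gamma> (ball_of z) \<noteq> 0 \<longrightarrow> z \<in> (\<Union>k. F k)"
      using part by (simp add: atomic_partition_def)
    then have "AE z in U. h z / emeasure \<gamma> (ball_of z) * ?i z
        = (\<Sum>k. ?h k z / emeasure \<gamma> (ball_of z) * ?i z)"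
    proof eventually_elim
      fix z assume *: "h z / emeasure \<gamma> (ball_of z) \<noteq> 0 \<longrightarrow> z \<in> (\<Union>k. F k)"
      have eq: "?h k z / emeasure \<gamma> (ball_of z) * ?i z
          = h z / emeasure \<gamma> (ball_of z) * ?i z * indicator (F k) z" for k
        by (simp add: indicator_def)
      show "h z / emeasure \<gamma> (ball_of z) * ?i z = (\<Sum>k. ?h k z / emeasure \<gamma> (ball_of z) * ?i z)"
      proof (cases "h z / emeasure \<gamma> (ball_of z) = 0")
        case True
        then show ?thesis by (simp only: eq) simp
      next
        case False
        then obtain k where "z \<in> F k" using * by blast
        then show ?thesis unfolding eq by (subst suminf_cmult_indicator[OF disj]) auto
      qed
    qed
    then have "cone_integral h x = (\<integral>\<^sup>+z. (\<Sum>k. ?h k z / emeasure \<gamma> (ball_of z) * ?i z) \<partial>U)"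
      unfolding cone_integral_def by (rule nn_integral_cong_AE)
    also have "\<dots> = (\<Sum>k. cone_integral (?h k) x)"
      unfolding cone_integral_def by (rule nn_integral_suminf) measurable
    finally show ?thesis .
  qed
  have "tent_size h \<le> (\<integral>\<^sup>+x. (\<Sum>k. area (?h k) x) \<partial>\<gamma>)"
    unfolding tent_size_def area_def split using q_ge_1
    by (intro nn_integral_mono ennreal_powr_suminf_le) auto
  also have "\<dots> = (\<Sum>k. tent_size (?h k))"
    unfolding tent_size_def by (rule nn_integral_suminf) measurable
  also have "\<dots> \<le> (\<Sum>k. 2 * ennreal (l k))"
    using part by (intro suminf_le tent_size_atomic_set h) (auto simp: atomic_partition_def)
  finally show ?thesis by simp
qed

section \<open>From atomic sets to atoms\<close>

definition dens :: "('a \<times> real \<Rightarrow> 'b::real_normed_vector) \<Rightarrow> 'a \<times> real \<Rightarrow> ennreal" where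
  "dens f z = ennreal (norm (f z) powr q) * indicator D z"

lemma area_functional_eq: "area_functional \<gamma> m q f x = area (dens f) x"
proof -
  have "ennreal (norm (f z) powr q) / emeasure \<gamma> (ball_of z) * indicator (local_cone m x) z
      = dens f z / emeasure \<gamma> (ball_of z) * indicator {z. dist x (fst z) < snd z} z" for z
    by (auto simp: dens_def local_cone_def indicator_def)
  then show ?thesis by (simp add: area_functional_def area_def cone_integral_def)
qed

lemma tent_norm_eq: "tent_norm \<gamma> m q f = tent_size (dens f)"
  by (simp add: tent_norm_def tent_size_def area_functional_eq)

lemma measurable_dens:
  fixes f :: "'a \<times> real \<Rightarrow> 'b::{real_normed_vector, second_countable_topology}"
  assumes "set_borel_measurable U D f"
  shows "dens f \<in> borel_measurable U"
proof -
  have [measurable]: "(\<lambda>z. indicator D z *\<^sub>R f z) \<in> borel_measurable U"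
    using assms by (simp add: set_borel_measurable_def)
  have eq: "dens f = (\<lambda>z. ennreal (norm (indicator D z *\<^sub>R f z) powr q))"
    using q_pos by (auto simp: dens_def indicator_def)
  show ?thesis unfolding eq by measurable
qed

lemma atomic_set_imp_atom:
  fixes f :: "'a \<times> real \<Rightarrow> 'b::{real_normed_field, second_countable_topology}"
  assumes f: "set_borel_measurable U D f" and at: "atomic_set (dens f) F l"
  shows "\<exists>a. tent_atom \<gamma> m q 5 a \<and> (\<forall>z. of_real l * a z = indicator F z *\<^sub>R f z)"
proof (cases "F = {}")
  case True
  have "0 < m undefined" by (rule m_pos)
  then have "(undefined, m undefined) \<in> admissible_balls m 5" by (simp add: admissible_balls_def)
  then have "tent_atom \<gamma> m q 5 (\<lambda>z. 0 :: 'b)"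
    unfolding tent_atom_def using q_pos
    by (intro conjI bexI[of _ "(undefined, m undefined)"])
      (auto simp: set_borel_measurable_def support_on_def)
  then show ?thesis using True by (intro exI[of _ "\<lambda>z. 0"]) simp
next
  case False
  then obtain c r where F [measurable]: "F \<in> sets U" and l: "0 < l"
    and adm: "(c, r) \<in> admissible_balls m 5"
    and sub: "\<And>z. z \<in> F \<Longrightarrow> ball_of z \<subseteq> ball c r" and fin: "emeasure \<gamma> (ball c r) \<noteq> \<infinity>"
    and bound: "(\<integral>\<^sup>+z\<in>F. dens f z \<partial>U) \<le> ennreal (l powr q * measure \<gamma> (ball c r) powr (1 - q))"
    using at unfolding atomic_set_def by blast
  define b where "b = measure \<gamma> (ball c r)"
  have em: "emeasure \<gamma> (ball c r) = ennreal b"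
    unfolding b_def using fin by (intro emeasure_eq_ennreal_measure) simp
  have b: "0 < b" using ball_pos[of r c] adm em
    by (cases "b = 0") (auto simp: b_def less_le admissible_balls_def)
  define a where "a z = (indicator F z / l) *\<^sub>R f z" for z
  have [measurable]: "(\<lambda>z. indicator D z *\<^sub>R f z) \<in> borel_measurable U"
    using f by (simp add: set_borel_measurable_def)
  have eq: "(\<lambda>z. indicator D z *\<^sub>R a z) = (\<lambda>z. (indicator F z / l) *\<^sub>R (indicator D z *\<^sub>R f z))"
    by (auto simp: a_def indicator_def)
  have meas: "set_borel_measurable U D a" unfolding set_borel_measurable_def eq by measurable
  have tent: "z \<in> admissible_tent m (ball c r)" if "z \<in> F" "z \<in> D" for z
    using sub[OF that(1)] that(2)
    by (auto simp: admissible_tent_def local_cone_def subset_iff dist_commute)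
  have supp: "support_on D a \<subseteq> admissible_tent m (ball c r)"
    using tent by (auto simp: support_on_def a_def indicator_def split: if_splits)
  have "(\<integral>\<^sup>+z\<in>admissible_tent m (ball c r). ennreal (norm (a z) powr q) \<partial>U)
      \<le> (\<integral>\<^sup>+z. ennreal (1 / l powr q) * (dens f z * indicator F z) \<partial>U)"
  proof (rule nn_integral_mono)
    fix z
    show "ennreal (norm (a z) powr q) * indicator (admissible_tent m (ball c r)) z
        \<le> ennreal (1 / l powr q) * (dens f z * indicator F z)"
    proof (cases "z \<in> F \<and> z \<in> D")
      case True
      then have "norm (a z) powr q = 1 / l powr q * norm (f z) powr q"
        using l by (simp add: a_def powr_divide)
      then have "ennreal (norm (a z) powr q) = ennreal (1 / l powr q) * ennreal (norm (f z) powr q)"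
        by (simp only:) (rule ennreal_mult, simp_all)
      then show ?thesis using True by (simp add: dens_def indicator_def)
    next
      case False
      then show ?thesis using q_pos by (auto simp: a_def admissible_tent_def indicator_def)
    qed
  qed
  also have "\<dots> = ennreal (1 / l powr q) * (\<integral>\<^sup>+z\<in>F. dens f z \<partial>U)"
    using measurable_dens[OF f] F by (intro nn_integral_cmult) simp
  also have "\<dots> \<le> ennreal (1 / l powr q) * ennreal (l powr q * b powr (1 - q))"
    using bound by (intro mult_left_mono) (auto simp: b_def)
  also have "\<dots> = ennreal (b powr (1 - q))" using l by (simp add: ennreal_mult[symmetric])
  also have "\<dots> = 1 / ennreal_powr (emeasure \<gamma> (ball c r)) (q - 1)"
  proof (cases "q = 1")
    case True
    then show ?thesis using b by (simp add: ennreal_powr_def)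
  next
    case False
    then have "1 / ennreal_powr (emeasure \<gamma> (ball c r)) (q - 1) = ennreal 1 / ennreal (b powr (q - 1))"
      using b q_ge_1 em by (simp add: ennreal_powr_ennreal)
    also have "\<dots> = ennreal (1 / b powr (q - 1))" using b by (intro divide_ennreal) auto
    also have "1 / b powr (q - 1) = b powr (1 - q)" using b by (simp add: powr_diff)
    finally show ?thesis by simp
  qed
  finally have "tent_atom \<gamma> m q 5 a"
    unfolding tent_atom_def using meas adm supp by blast
  moreover have "of_real l * a z = indicator F z *\<^sub>R f z" for z
    using l by (simp add: a_def scaleR_conv_of_real)
  ultimately show ?thesis by blast
qed

text \<open>
  The sets \<open>F k\<close> are disjoint, so subtracting the first \<open>n\<close> pieces restricts \<open>f\<close> to the
  complement of their union.
\<close>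

lemma tent_norm_remainder_tendsto_0:
  fixes f :: "'a \<times> real \<Rightarrow> 'b::{real_normed_field, second_countable_topology}"
  assumes f: "f \<in> local_tent_space \<gamma> m q" and part: "atomic_partition (dens f) F l"
  shows "(\<lambda>n. tent_norm \<gamma> m q (\<lambda>z. f z - (\<Sum>k<n. indicator (F k) z *\<^sub>R f z))) \<longlonglongrightarrow> 0"
proof -
  have F [measurable]: "F k \<in> sets U" for k
    using part by (simp add: atomic_partition_def atomic_set_def)
  have disj: "disjoint_family F" using part by (simp add: atomic_partition_def)
  define G where "G n = space U - (\<Union>k<n. F k)" for n
  have eq: "dens (\<lambda>z. f z - (\<Sum>k<n. indicator (F k) z *\<^sub>R f z)) = (\<lambda>z. dens f z * indicator (G n) z)" for n
  proof
    fix z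
    have eq: "(\<Sum>k<n. indicator (F k) z *\<^sub>R f z) = indicator (\<Union>k<n. F k) z *\<^sub>R f z"
      using disjoint_family_on_mono[OF subset_UNIV disj, of "{..<n}"]
      by (simp add: indicator_UN_disjoint scaleR_sum_left)
    show "dens (\<lambda>z. f z - (\<Sum>k<n. indicator (F k) z *\<^sub>R f z)) z = dens f z * indicator (G n) z"
      unfolding dens_def eq using q_pos by (cases "z \<in> (\<Union>k<n. F k)") (auto simp: G_def)
  qed
  have "(\<lambda>n. tent_size (\<lambda>z. dens f z * indicator (G n) z)) \<longlonglongrightarrow> 0"
  proof (rule tent_size_tendsto_0)
    show "dens f \<in> borel_measurable U" "tent_size (dens f) < \<infinity>"
      using f measurable_dens by (auto simp: local_tent_space_def tent_norm_eq)
    show "G n \<in> sets U" for n unfolding G_def by measurable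
    have "AE z in U. dens f z / emeasure \<gamma> (ball_of z) \<noteq> 0 \<longrightarrow> z \<in> (\<Union>k. F k)"
      using part by (simp add: atomic_partition_def)
    then show "AE z in U. dens f z / emeasure \<gamma> (ball_of z) \<noteq> 0 \<longrightarrow> eventually (\<lambda>n. z \<notin> G n) sequentially"
    proof (eventually_elim, intro impI)
      fix z assume "dens f z / emeasure \<gamma> (ball_of z) \<noteq> 0 \<longrightarrow> z \<in> (\<Union>k. F k)"
        "dens f z / emeasure \<gamma> (ball_of z) \<noteq> 0"
      then obtain k where "z \<in> F k" by blast
      then show "eventually (\<lambda>n. z \<notin> G n) sequentially"
        by (intro eventually_sequentiallyI[of "Suc k"]) (auto simp: G_def)
    qed
  qed
  then show ?thesis unfolding tent_norm_eq eq .
qed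

lemma atomic_decomposition:
  "\<exists>C::real. 1 \<le> C \<and>
    (\<forall>f :: 'a \<times> real \<Rightarrow> 'b::{real_normed_field, second_countable_topology}.
       f \<in> local_tent_space \<gamma> m q \<longrightarrow>
       (\<exists>(a :: nat \<Rightarrow> 'a \<times> real \<Rightarrow> 'b) (lam :: nat \<Rightarrow> 'b).
          (\<forall>k. tent_atom \<gamma> m q 5 (a k)) \<and>
          (\<lambda>n. tent_norm \<gamma> m q (\<lambda>z. f z - (\<Sum>k<n. lam k * a k z))) \<longlonglongrightarrow> 0 \<and>
          (\<Sum>k. ennreal (norm (lam k))) \<le> ennreal C * tent_norm \<gamma> m q f \<and>
          tent_norm \<gamma> m q f \<le> ennreal C * (\<Sum>k. ennreal (norm (lam k)))))"
proof -
  obtain K where K: "1 \<le> K" "\<And>z. z \<in> D \<Longrightarrow>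
    emeasure \<gamma> (ball (fst z) (5 * snd z)) \<le> ennreal K * emeasure \<gamma> (ball_of z)"
    by (rule doubling_fivefold) blast
  show ?thesis
  proof (intro exI[of _ "32 * K"] conjI allI impI)
    show "1 \<le> 32 * K" using K(1) by simp
    fix f :: "'a \<times> real \<Rightarrow> 'b" assume f: "f \<in> local_tent_space \<gamma> m q"
    then have meas: "set_borel_measurable U D f" and fin: "tent_size (dens f) < \<infinity>"
      by (auto simp: local_tent_space_def tent_norm_eq)
    have "\<exists>F l. atomic_partition (dens f) F l \<and>
        (\<Sum>k. ennreal (l k)) \<le> ennreal (32 * K) * tent_size (dens f)"
    proof (rule atomic_partition_exists[OF measurable_dens[OF meas] _ fin])
      show "z \<in> D" if "dens f z \<noteq> 0" for z using that by (simp add: dens_def indicator_def split: if_splits)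
    qed (use K in auto)
    then obtain F l where part: "atomic_partition (dens f) F l"
      and sum: "(\<Sum>k. ennreal (l k)) \<le> ennreal (32 * K) * tent_size (dens f)" by blast
    have at: "atomic_set (dens f) (F k) (l k)" for k using part by (simp add: atomic_partition_def)
    have l: "0 \<le> l k" for k using at[of k] by (auto simp: atomic_set_def)
    obtain a where a: "\<And>k. tent_atom \<gamma> m q 5 (a k)"
      "\<And>k z. of_real (l k) * a k z = indicator (F k) z *\<^sub>R f z"
      using atomic_set_imp_atom[OF meas at] by metis
    have norm_l: "norm (of_real (l k) :: 'b) = l k" for k using l[of k] by simp
    have le: "tent_size (dens f) \<le> ennreal (32 * K) * (\<Sum>k. ennreal (l k))"
    proof -
      have "ennreal 2 \<le> ennreal (32 * K)" using K(1) by (intro ennreal_leI) auto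
      then have "2 * (\<Sum>k. ennreal (l k)) \<le> ennreal (32 * K) * (\<Sum>k. ennreal (l k))"
        by (intro mult_right_mono) auto
      then show ?thesis using tent_size_le_sum_atomic_sets[OF measurable_dens[OF meas] part]
        by (rule order_trans[rotated])
    qed
    show "\<exists>a lam. (\<forall>k. tent_atom \<gamma> m q 5 (a k)) \<and>
          (\<lambda>n. tent_norm \<gamma> m q (\<lambda>z. f z - (\<Sum>k<n. lam k * a k z))) \<longlonglongrightarrow> 0 \<and>
          (\<Sum>k. ennreal (norm (lam k))) \<le> ennreal (32 * K) * tent_norm \<gamma> m q f \<and>
          tent_norm \<gamma> m q f \<le> ennreal (32 * K) * (\<Sum>k. ennreal (norm (lam k :: 'b)))"
      using tent_norm_remainder_tendsto_0[OF f part] a sum le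
      by (intro exI[of _ a] exI[of _ "\<lambda>k. of_real (l k)"] conjI allI)
        (simp_all only: norm_l tent_norm_eq a(2))
  qed
qed

end

lemma sigma_finite_measure_finite_balls:
  fixes \<mu> :: "'a::metric_space measure"
  assumes "sets \<mu> = sets borel" "\<And>x r. 0 < r \<Longrightarrow> emeasure \<mu> (ball x r) \<noteq> \<infinity>"
  shows "sigma_finite_measure \<mu>"
proof
  fix x0 :: 'a
  have sp: "space \<mu> = UNIV" using sets_eq_imp_space_eq[OF assms(1)] by simp
  let ?A = "range (\<lambda>n. ball x0 (real (Suc n)))"
  have "x \<in> \<Union>?A" for x
  proof -
    obtain n where "dist x0 x \<le> real n" using real_arch_simple by blast
    then have "dist x0 x < real (Suc n)" by simp
    then show ?thesis by auto
  qed
  then have "countable ?A \<and> ?A \<subseteq> sets \<mu> \<and> \<Union>?A = space \<mu> \<and> (\<forall>a\<in>?A. emeasure \<mu> a \<noteq> \<infinity>)"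
    using assms sp by auto
  then show "\<exists>A. countable A \<and> A \<subseteq> sets \<mu> \<and> \<Union>A = space \<mu> \<and> (\<forall>a\<in>A. emeasure \<mu> a \<noteq> \<infinity>)"
    by (rule exI[of _ ?A])
qed

theorem theorem4p5:
  fixes \<mu> \<gamma> :: "'a::metric_space measure"
    and \<phi> m :: "'a \<Rightarrow> real"
    and q :: real
  assumes borel: "sets \<mu> = sets borel"
    and balls: "\<And>x r. 0 < r \<Longrightarrow> emeasure \<mu> (ball x r) \<noteq> 0 \<and> emeasure \<mu> (ball x r) \<noteq> \<infinity>"
    and geom: "geometrically_doubling TYPE('a)"
    and phi: "\<phi> \<in> borel_measurable \<mu>"
    and gamma: "\<gamma> = density \<mu> (\<lambda>x. ennreal (exp (- \<phi> x)))"
    and m_pos: "\<And>x. 0 < m x"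
    and doubling: "admissibly_doubling \<gamma> m"
    and complete: "complete (UNIV :: 'a set)"
    and q: "1 \<le> q"
  shows "\<exists>C::real. 1 \<le> C \<and>
    (\<forall>f :: 'a \<times> real \<Rightarrow> 'b::{real_normed_field, second_countable_topology}.
       f \<in> local_tent_space \<gamma> m q \<longrightarrow>
       (\<exists>(a :: nat \<Rightarrow> 'a \<times> real \<Rightarrow> 'b) (lam :: nat \<Rightarrow> 'b).
          (\<forall>k. tent_atom \<gamma> m q 5 (a k)) \<and>
          (\<lambda>n. tent_norm \<gamma> m q (\<lambda>z. f z - (\<Sum>k<n. lam k * a k z))) \<longlonglongrightarrow> 0 \<and>
          (\<Sum>k. ennreal (norm (lam k))) \<le> ennreal C * tent_norm \<gamma> m q f \<and>
          tent_norm \<gamma> m q f \<le> ennreal C * (\<Sum>k. ennreal (norm (lam k)))))"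
proof -
  interpret \<mu>: sigma_finite_measure \<mu>
    using borel balls by (intro sigma_finite_measure_finite_balls) auto
  have [measurable]: "\<phi> \<in> borel_measurable \<mu>" by (rule phi)
  have "sigma_finite_measure \<gamma>"
    unfolding gamma by (subst \<mu>.sigma_finite_iff_density_finite) auto
  moreover have "emeasure \<gamma> (ball x r) \<noteq> 0" if "0 < r" for x r
  proof
    have ball: "ball x r \<in> sets \<mu>" using borel by simp
    assume "emeasure \<gamma> (ball x r) = 0"
    then have "(\<integral>\<^sup>+y\<in>ball x r. ennreal (exp (- \<phi> y)) \<partial>\<mu>) = 0"
      using ball unfolding gamma by (subst (asm) emeasure_density) auto
    then have "AE y in \<mu>. ennreal (exp (- \<phi> y)) * indicator (ball x r) y = 0"
      using ball by (subst (asm) nn_integral_0_iff_AE) auto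
    then have "AE y in \<mu>. y \<notin> ball x r"
      by eventually_elim (auto simp: indicator_def split: if_splits)
    then have "emeasure \<mu> (ball x r) = 0"
      using ball by (subst (asm) AE_iff_measurable[OF ball]) (auto dest: sets.sets_into_space)
    with balls[OF that, of x] show False by simp
  qed
  ultimately interpret admissible_measure \<gamma> m q
    using borel m_pos doubling q
    by (intro admissible_measure.intro admissible_measure_axioms.intro) (auto simp: gamma)
  show ?thesis by (rule atomic_decomposition)
qed

end
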